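(* Let $\sim$ be a $\sigma_d$-invariant lamination ($d\ge2$) whose topological Julia set $J_\sim$ is a dendrite, let $f_\sim:J_\sim\to J_\sim$ be the corresponding topological polynomial, and let $\mu$ be an $f_\sim$-invariant probability measure on $J_\sim$. Then $\mu$ can be represented as a convex combination of two $f_\sim$-invariant probability measures $\mu_e$ and $\mu_c$, where $\mu_e$ is supported on the set of all endpoints of $J_\sim$ and $\mu_c$ is supported on the set of cutpoints of $J_\sim$ intersected with the closure of the set of all periodic cutpoints of $f_\sim$.
   Context: Laminations. Let $\mathbb{S}^1\subset\mathbb{C}$ be the unit circle and let $\sigma_d:\mathbb{S}^1\to\mathbb{S}^1$, $\sigma_d(z)=z^d$, $d\ge2$. An equivalence relation $\sim$ on $\mathbb{S}^1$ is a lamination if: (E1) its graph is closed in $\mathbb{S}^1\times\mathbb{S}^1$; (E2) if $t_1\sim t_2$ and $t_3\sim t_4$ but $t_2\not\sim t_3$, then the open straight line segments in $\mathbb{C}$ with endpoints $t_1,t_2$ and $t_3,t_4$ are disjoint; (E3) each $\sim$-class is totally disconnected. A lamination $\sim$ is $\sigma_d$-invariant if: (D1) for every class $g$, $\sigma_d(g)$ is a class; (D2) for every class $g$, the preimage $\sigma_d^{-1}(g)$ splits into at most $d$ classes; (D3) for every class $g$, the map $\sigma_d:g\to\sigma_d(g)$ extends to $\mathbb{S}^1$ as an orientation preserving covering map such that $g$ is the full preimage of $\sigma_d(g)$ under this covering map; (D4) all classes are finite. For a $\sigma_d$-invariant lamination $\sim$, the quotient space $J_\sim=\mathbb{S}^1/\sim$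 is called the topological Julia set and the map $f_\sim:J_\sim\to J_\sim$ induced by $\sigma_d$ is called a topological polynomial. Dendrites. A dendrite is a non-degenerate locally connected continuum which contains no Jordan curve. A point $x$ of a dendrite $X$ is an endpoint of $X$ if $X\setminus\{x\}$ is connected and a cutpoint of $X$ if $X\setminus\{x\}$ is disconnected. A periodic cutpoint of $f_\sim$ is a cutpoint of $J_\sim$ which is periodic under $f_\sim$. Measures are Borel. A probability measure $\mu$ is supported on a set $A$ if $\mu(A)=1$. *)

theory Defs
  imports "HOL-Probability.Probability"
begin

section \<open>Invariant laminations\<close>

abbreviation unit_circle :: "complex set" where
  "unit_circle \<equiv> sphere 0 1"

definition sigma_map :: "nat \<Rightarrow> complex \<Rightarrow> complex" where
  "sigma_map d z = z ^ d"

definition lamination :: "(complex \<times> complex) set \<Rightarrow> bool" where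
  "lamination R \<longleftrightarrow>
     equiv unit_circle R \<and>
     closedin (top_of_set (unit_circle \<times> unit_circle)) R \<and>
     (\<forall>t1 t2 t3 t4. (t1, t2) \<in> R \<longrightarrow> (t3, t4) \<in> R \<longrightarrow> (t2, t3) \<notin> R \<longrightarrow>
        open_segment t1 t2 \<inter> open_segment t3 t4 = {}) \<and>
     (\<forall>g \<in> unit_circle // R. \<forall>C. C \<subseteq> g \<longrightarrow> connected C \<longrightarrow> (\<exists>x. C \<subseteq> {x}))"

text \<open>A covering map of the circle preserves orientation iff it lifts, along
  the universal covering \<open>cis\<close>, to an increasing map of the real line.\<close>

definition orientation_preserving_covering :: "(complex \<Rightarrow> complex) \<Rightarrow> bool" where
  "orientation_preserving_covering \<phi> \<longleftrightarrow>
     covering_space unit_circle \<phi> unit_circle \<and>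
     (\<exists>\<psi> :: real \<Rightarrow> real. continuous_on UNIV \<psi> \<and> strict_mono \<psi> \<and>
        (\<forall>t. \<phi> (cis t) = cis (\<psi> t)))"

definition invariant_lamination :: "nat \<Rightarrow> (complex \<times> complex) set \<Rightarrow> bool" where
  "invariant_lamination d R \<longleftrightarrow>
     lamination R \<and>
     (\<forall>g \<in> unit_circle // R. sigma_map d ` g \<in> unit_circle // R) \<and>
     (\<forall>g \<in> unit_circle // R. \<exists>\<C>. \<C> \<subseteq> unit_circle // R \<and> finite \<C> \<and> card \<C> \<le> d \<and>
        {z \<in> unit_circle. sigma_map d z \<in> g} = \<Union>\<C>) \<and>
     (\<forall>g \<in> unit_circle // R. \<exists>\<phi>. orientation_preserving_covering \<phi> \<and>
        (\<forall>z \<in> g. \<phi> z = sigma_map d z) \<and>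
        {z \<in> unit_circle. \<phi> z \<in> sigma_map d ` g} = g) \<and>
     (\<forall>g \<in> unit_circle // R. finite g)"

section \<open>Topological Julia sets and topological polynomials\<close>

definition quotient_topology :: "'a topology \<Rightarrow> ('a \<times> 'a) set \<Rightarrow> 'a set topology" where
  "quotient_topology X R =
     topology (\<lambda>U. U \<subseteq> topspace X // R \<and> openin X {x \<in> topspace X. R `` {x} \<in> U})"

lemma openin_quotient_topology:
  "openin (quotient_topology X R) U \<longleftrightarrow>
     U \<subseteq> topspace X // R \<and> openin X {x \<in> topspace X. R `` {x} \<in> U}"
proof -
  have "istopology (\<lambda>U. U \<subseteq> topspace X // R \<and> openin X {x \<in> topspace X. R `` {x} \<in> U})"
    unfolding istopology_def
  proof (intro conjI allI impI)
    fix S T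
    assume "S \<subseteq> topspace X // R \<and> openin X {x \<in> topspace X. R `` {x} \<in> S}"
      and "T \<subseteq> topspace X // R \<and> openin X {x \<in> topspace X. R `` {x} \<in> T}"
    moreover have "{x \<in> topspace X. R `` {x} \<in> S \<inter> T} =
      {x \<in> topspace X. R `` {x} \<in> S} \<inter> {x \<in> topspace X. R `` {x} \<in> T}" by auto
    ultimately show "S \<inter> T \<subseteq> topspace X // R"
      "openin X {x \<in> topspace X. R `` {x} \<in> S \<inter> T}" by auto
  next
    fix \<K>
    assume K: "\<forall>K\<in>\<K>. K \<subseteq> topspace X // R \<and> openin X {x \<in> topspace X. R `` {x} \<in> K}"
    moreover have "{x \<in> topspace X. R `` {x} \<in> \<Union>\<K>} =
      (\<Union>K\<in>\<K>. {x \<in> topspace X. R `` {x} \<in> K})" by auto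
    ultimately show "\<Union>\<K> \<subseteq> topspace X // R" "openin X {x \<in> topspace X. R `` {x} \<in> \<Union>\<K>}"
      by auto
  qed
  then show ?thesis
    by (simp add: quotient_topology_def topology_inverse')
qed

lemma topspace_quotient_topology [simp]:
  "topspace (quotient_topology X R) = topspace X // R"
proof -
  have "{x \<in> topspace X. R `` {x} \<in> topspace X // R} = topspace X"
    by (auto intro: quotientI)
  then have "openin (quotient_topology X R) (topspace X // R)"
    by (simp add: openin_quotient_topology)
  then show ?thesis
    by (meson openin_quotient_topology openin_subset openin_topspace subset_antisym)
qed

definition julia :: "(complex \<times> complex) set \<Rightarrow> complex set topology" where
  "julia R = quotient_topology (top_of_set unit_circle) R"

text \<open>The map induced on classes: for an invariant lamination the union of the
  classes of the points \<open>sigma_map d z\<close>, \<open>z \<in> g\<close>, is a single class.\<close>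

definition top_poly :: "nat \<Rightarrow> (complex \<times> complex) set \<Rightarrow> complex set \<Rightarrow> complex set" where
  "top_poly d R g = R `` (sigma_map d ` g)"

lemma top_poly_class:
  assumes "invariant_lamination d R" "z \<in> unit_circle"
  shows "top_poly d R (R `` {z}) = R `` {sigma_map d z}"
proof -
  have eq: "equiv unit_circle R"
    using assms(1) by (auto simp: invariant_lamination_def lamination_def)
  have z: "z \<in> R `` {z}" using eq assms(2) by (rule equiv_class_self)
  have "sigma_map d ` (R `` {z}) \<in> unit_circle // R"
    using assms(1)[unfolded invariant_lamination_def, THEN conjunct2, THEN conjunct1]
      quotientI[OF assms(2)] by (rule bspec)
  then obtain w where w: "w \<in> unit_circle" "sigma_map d ` (R `` {z}) = R `` {w}"
    by (rule quotientE)
  then have wz: "(w, sigma_map d z) \<in> R" using z by blast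
  have "R O R = R"
    using equiv_comp_eq[OF eq] eq by (simp add: equiv_def sym_conv_converse_eq)
  then have idem: "R `` (R `` {w}) = R `` {w}"
    using relcomp_Image[of R R "{w}"] by argo
  have "top_poly d R (R `` {z}) = R `` (R `` {w})"
    unfolding top_poly_def w(2) ..
  also have "\<dots> = R `` {sigma_map d z}"
    using idem equiv_class_eq[OF eq wz] by (rule trans)
  finally show ?thesis .
qed

section \<open>Dendrites\<close>

definition dendrite :: "'a topology \<Rightarrow> bool" where
  "dendrite X \<longleftrightarrow>
     metrizable_space X \<and> compact_space X \<and> connected_space X \<and>
     locally_connected_space X \<and>
     (\<exists>x \<in> topspace X. \<exists>y \<in> topspace X. x \<noteq> y) \<and>
     \<not> (\<exists>C \<subseteq> topspace X. subtopology X C homeomorphic_space top_of_set unit_circle)"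

definition endpoints :: "'a topology \<Rightarrow> 'a set" where
  "endpoints X = {x \<in> topspace X. connectedin X (topspace X - {x})}"

definition cutpoints :: "'a topology \<Rightarrow> 'a set" where
  "cutpoints X = {x \<in> topspace X. \<not> connectedin X (topspace X - {x})}"

definition periodic_cutpoints :: "'a topology \<Rightarrow> ('a \<Rightarrow> 'a) \<Rightarrow> 'a set" where
  "periodic_cutpoints X f = {x \<in> cutpoints X. \<exists>n \<ge> 1. (f ^^ n) x = x}"

section \<open>Invariant Borel probability measures\<close>

definition borel_of :: "'a topology \<Rightarrow> 'a measure" where
  "borel_of X = sigma (topspace X) {U. openin X U}"

definition invariant_prob :: "'a topology \<Rightarrow> ('a \<Rightarrow> 'a) \<Rightarrow> 'a measure \<Rightarrow> bool" where
  "invariant_prob X f M \<longleftrightarrow>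
     prob_space M \<and> sets M = sets (borel_of X) \<and> f \<in> measurable M M \<and>
     (\<forall>A \<in> sets M. measure M (f -` A \<inter> space M) = measure M A)"

text \<open>Since \<open>measure M A = 0\<close> whenever \<open>A \<notin> sets M\<close>, being supported on \<open>A\<close>
  includes the measurability of \<open>A\<close>.\<close>

definition supported_on :: "'a measure \<Rightarrow> 'a set \<Rightarrow> bool" where
  "supported_on M A \<longleftrightarrow> measure M A = 1"

end

theory Submission
  imports Defs
begin

text \<open>
  Measure angles in turns, so that \<open>t\<close> stands for the point \<open>cis (2 * pi * t)\<close> of the circle and
  \<open>sigma_map d\<close> becomes multiplication by \<open>d\<close>. A point of the Julia set is a class of angles. Classes
  are unlinked, so every class lies in a single complementary arc of every other class; hence the
  cutpoints are the classes with at least two angles and the endpoints are those with exactly one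
  (\<open>cutpoint_iff\<close>, \<open>endpoint_iff\<close>). A class with one angle is mapped to a class with one angle, so
  the set of endpoints is contained in its preimage, and invariance of the measure makes the two
  differ by a null set only. Therefore restricting the measure to the endpoints and to the
  cutpoints, and normalizing, gives invariant measures. If one of the two restrictions vanishes,
  any invariant measure carried by the respective set will do, and a periodic orbit supplies one:
  there is a fixed class with two angles (\<open>exists_fixed_cut\<close>) and a periodic class with a single
  angle (\<open>exists_periodic_singleton\<close>).

  The heart of the matter is that almost every cutpoint is a limit of periodic cutpoints. Poincare
  recurrence, applied to the countably many closed sets of classes that meet two given rational
  arcs, shows the following for almost every cutpoint \<open>x\<close>: given angles \<open>a\<close>, \<open>b\<close> of \<open>x\<close>, some
  later image of \<open>x\<close> has an angle near \<open>a\<close> and an angle near \<open>b\<close>. If \<open>x\<close> is not periodic, two such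
  images, at times \<open>n < m\<close>, lie on the same side of \<open>x\<close>, and the three chords are nested with the
  later image between \<open>x\<close> and the earlier one. Say that a map moves a chord inward or outward
  according to the side on which the image of its class lies. Then time \<open>n\<close> moves the outermost
  chord, that of \<open>x\<close>, inward, while time \<open>m - n\<close> moves the innermost chord outward. If no
  periodic cutpoint has an angle in the strip between these chords, both directions persist for all
  multiples of these times, because then no iterate moves a chord of the strip inward and a chord
  nested in it outward (\<open>inward_outward_fixed_cut\<close>). Time \<open>n * (m - n)\<close> is a contradiction
  (\<open>nested_returns_periodic_cut\<close>).

  That impossibility is an intermediate value theorem, and it has two sources. First, the chords
  that cross a strip behave like a connected set (\<open>crossing_pairs_equivalent\<close>): between any two
  inequivalent ones there is a third, because the points of a dendrite are separated by cutpoints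
  (\<open>dendrite_separates\<close>). So there is a class with one crossing chord moved inward and another one moved
  outward; unless it is fixed, its image lies in an arc between two of its own angles inside the strip.
  Second, such an arc contains a fixed class with two angles (\<open>inward_fixed_cut\<close>): multiplication by
  \<open>d\<close> expands, so arcs of this kind cannot be short, a shortest one exists, and at a shortest one the
  class must be fixed.
\<close>

section \<open>Lamination equivalences on the line of angles\<close>

text \<open>For \<open>p\<close> in the complement, the integer \<open>m\<close> with \<open>m - 1 < f p \<le> m\<close> also shows at nearby
  points that no integer lies between the two values; so the complement is open.\<close>

lemma closed_int_between:
  fixes f g :: "'a::topological_space \<Rightarrow> real"
  assumes "continuous_on UNIV f" "continuous_on UNIV g"
  shows "closed {p. \<exists>j::int. f p \<le> j \<and> j \<le> g p}"
proof -
  have "- {p. \<exists>j::int. f p \<le> j \<and> j \<le> g p} = (\<Union>m::int. {p. m - 1 < f p} \<inter> {p. g p < m})"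
    (is "?l = ?r")
  proof (intro equalityI subsetI)
    fix p assume p: "p \<in> ?l"
    have "f p \<le> \<lceil>f p\<rceil>" "\<lceil>f p\<rceil> - 1 < f p" by linarith+
    moreover from this p have "\<not> real_of_int \<lceil>f p\<rceil> \<le> g p" by blast
    ultimately have "p \<in> {q. real_of_int \<lceil>f p\<rceil> - 1 < f q} \<inter> {q. g q < \<lceil>f p\<rceil>}"
      by simp
    then show "p \<in> ?r" by blast
  next
    fix p assume "p \<in> ?r"
    then obtain m :: int where m: "m - 1 < f p" "g p < m" by auto
    have "\<not> (f p \<le> j \<and> j \<le> g p)" for j :: int
    proof
      assume "f p \<le> j \<and> j \<le> g p"
      with m have "real_of_int (m - 1) < j" "real_of_int j < m" by auto
      then show False unfolding of_int_less_iff by linarith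
    qed
    then show "p \<in> ?l" by auto
  qed
  moreover have "open ?r"
    using assms by (intro open_UN ballI open_Int open_Collect_less) auto
  ultimately show ?thesis by (simp add: closed_def)
qed

text \<open>A lamination equivalence pulled back to the line along the covering \<open>x \<mapsto> cis (2 * pi * x)\<close>. The
  assumption \<open>separated\<close> is the form in which the quotient being a dendrite enters: two distinct
  classes are separated by a third one, which has angles in both arcs between them.\<close>

locale angle_lamination =
  fixes E :: "real \<Rightarrow> real \<Rightarrow> bool"
  assumes refl [simp]: "E x x"
    and sym: "E x y \<Longrightarrow> E y x"
    and trans: "E x y \<Longrightarrow> E y z \<Longrightarrow> E x z"
    and shift: "E x (x + of_int k)"
    and closed_graph: "closed {p. E (fst p) (snd p)}"
    and unlinked: "\<lbrakk>a < c; c < b; b < e; e < a + 1; E a b; E c e\<rbrakk> \<Longrightarrow> E a c"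
    and separated: "\<lbrakk>a < b; b < a + 1; \<not> E a b\<rbrakk> \<Longrightarrow>
      \<exists>s t. a < s \<and> s < b \<and> b < t \<and> t < a + 1 \<and> E s t \<and> \<not> E a s \<and> \<not> E b s"
    and finite_class: "finite {y \<in> {x..<x+1}. E x y}"
begin

lemma shift_iff [simp]: "E x (y + of_int k) \<longleftrightarrow> E x y" "E x (y - of_int k) \<longleftrightarrow> E x y"
  "E (x + of_int k) y \<longleftrightarrow> E x y" "E (x - of_int k) y \<longleftrightarrow> E x y"
  "E x (y + 1) \<longleftrightarrow> E x y" "E (x + 1) y \<longleftrightarrow> E x y"
proof -
  have 1: "E x (y + of_int k) \<longleftrightarrow> E x y" for x y k
    using shift sym trans by blast
  have 2: "E (x + of_int k) y \<longleftrightarrow> E x y" for x y k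
    using 1 sym by blast
  show "E x (y + of_int k) \<longleftrightarrow> E x y" "E (x + of_int k) y \<longleftrightarrow> E x y" by (fact 1, fact 2)
  show "E x (y - of_int k) \<longleftrightarrow> E x y" "E (x - of_int k) y \<longleftrightarrow> E x y"
    using 1[of x y "-k"] 2[of x "-k" y] by simp_all
  show "E x (y + 1) \<longleftrightarrow> E x y" "E (x + 1) y \<longleftrightarrow> E x y"
    using 1[of x y 1] 2[of x 1 y] by simp_all
qed

text \<open>Unlinkedness in the form in which it is used: the arc between two equivalent angles is a trap
  for all other classes that meet it.\<close>

lemma class_in_arc:
  assumes "E u v" "u < x" "x < v" "v < u + 1" "E x y" "\<not> E u x"
  shows "\<exists>j::int. u < y - j \<and> y - j < v"
proof -
  define z where "z = y - of_int \<lfloor>y - u\<rfloor>"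
  have z: "u \<le> z" "z < u + 1" unfolding z_def by linarith+
  have xz: "E x z" using assms(5) by (simp add: z_def)
  have "z \<noteq> u" "z \<noteq> v" using xz assms(1,6) sym trans by blast+
  moreover have "\<not> v < z"
    using unlinked[of u x v z] assms z xz by auto
  ultimately have "u < z \<and> z < v" using z by auto
  then show ?thesis unfolding z_def by blast
qed

text \<open>An analogue of connectedness for the set of equivalent pairs \<open>(s, t)\<close> that cross a strip. If
  two closed sets cover it, take a shortest pair in the first set and, inside it, a longest pair in
  the second. A class that separates these two pairs would cross the strip between them and
  would belong to neither set, so the two pairs belong to the same class.\<close>

lemma crossing_pairs_equivalent:
  fixes A B :: "(real \<times> real) set"
  assumes ord: "s1 \<le> s2" "s2 \<le> t2" "t2 \<le> t1" "t1 < s1 + 1"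
    and "E s1 t1" "E s2 t2" "closed A" "closed B"
    and cover: "\<And>s t. \<lbrakk>s1 \<le> s; s \<le> s2; t2 \<le> t; t \<le> t1; E s t\<rbrakk> \<Longrightarrow> (s, t) \<in> A \<union> B"
    and "(s1, t1) \<in> A" "(s2, t2) \<in> B"
  obtains s t s' t' where "s1 \<le> s" "s \<le> s'" "s' \<le> s2" "t2 \<le> t'" "t' \<le> t" "t \<le> t1"
    "E s t" "E s s'" "E s t'" "(s, t) \<in> A" "(s', t') \<in> B"
proof -
  define K where "K x y = ({x..s2} \<times> {t2..y}) \<inter> {p. E (fst p) (snd p)}" for x y
  have comp: "compact (K x y)" for x y
    unfolding K_def by (intro compact_Int_closed compact_Times closed_graph) auto
  have "compact (K s1 t1 \<inter> A)" "(s1, t1) \<in> K s1 t1 \<inter> A"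
    using comp assms by (auto intro: compact_Int_closed simp: K_def)
  moreover have "continuous_on (K s1 t1 \<inter> A) (\<lambda>p. snd p - fst p)"
    by (intro continuous_intros)
  ultimately obtain p where p: "p \<in> K s1 t1 \<inter> A"
    "\<forall>q \<in> K s1 t1 \<inter> A. snd p - fst p \<le> snd q - fst q"
    using continuous_attains_inf[of "K s1 t1 \<inter> A"] by blast
  obtain s t where [simp]: "p = (s, t)" by force
  have st: "s1 \<le> s" "s \<le> s2" "t2 \<le> t" "t \<le> t1" "E s t" "(s, t) \<in> A"
    using p(1) by (auto simp: K_def)
  have minA: "t - s \<le> y - x"
    if "(x, y) \<in> A" "s1 \<le> x" "x \<le> s2" "t2 \<le> y" "y \<le> t1" "E x y" for x y
    using bspec[OF p(2), of "(x, y)"] that by (simp add: K_def)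
  have "compact (K s t \<inter> B)" "(s2, t2) \<in> K s t \<inter> B"
    using comp assms st by (auto intro: compact_Int_closed simp: K_def)
  moreover have "continuous_on (K s t \<inter> B) (\<lambda>p. snd p - fst p)"
    by (intro continuous_intros)
  ultimately obtain p' where p': "p' \<in> K s t \<inter> B"
    "\<forall>q \<in> K s t \<inter> B. snd q - fst q \<le> snd p' - fst p'"
    using continuous_attains_sup[of "K s t \<inter> B"] by blast
  obtain s' t' where [simp]: "p' = (s', t')" by force
  have st': "s \<le> s'" "s' \<le> s2" "t2 \<le> t'" "t' \<le> t" "E s' t'" "(s', t') \<in> B"
    using p'(1) by (auto simp: K_def)
  have maxB: "y - x \<le> t' - s'"
    if "(x, y) \<in> B" "s \<le> x" "x \<le> s2" "t2 \<le> y" "y \<le> t" "E x y" for x y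
    using bspec[OF p'(2), of "(x, y)"] that by (simp add: K_def)
  have "E s s'"
  proof (rule ccontr)
    assume ne: "\<not> E s s'"
    then have "s < s'" using st'(1) by (cases "s = s'") auto
    moreover have "t \<noteq> t'" using ne trans[OF st(5) sym] st'(5) by blast
    then have "t' < t" using st'(4) by simp
    moreover have "s' < s + 1" using ord st st' by linarith
    moreover have "t < s + 1" using ord st by linarith
    ultimately obtain u w where uw: "s < u" "u < s'" "s' < w" "w < s + 1" "E u w"
      "\<not> E s u" "\<not> E s' u"
      using separated[of s s'] ne by blast
    have "w \<noteq> t'" using uw(7) trans[OF st'(5) sym] uw(5) by blast
    moreover have "w \<noteq> t" using uw(6) trans[OF st(5) sym] uw(5) by blast
    moreover have "\<not> w < t'"
      using unlinked[of u s' w t'] uw st' sym \<open>t' < t\<close> \<open>t < s + 1\<close> by auto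
    moreover have "\<not> t < w"
      using unlinked[of s u t w] uw st st' ord by auto
    ultimately have w: "t' < w" "w < t" by auto
    have "(u, w) \<in> A \<union> B"
      using cover[of u w] uw w st st' by auto
    then show False
      using minA[of u w] maxB[of u w] uw w st st' by auto
  qed
  show thesis
    by (rule that[OF st(1) st'(1-4) st(4,5) \<open>E s s'\<close> trans[OF \<open>E s s'\<close> st'(5)] st(6) st'(6)])
qed

text \<open>The chord between the equivalent angles \<open>u\<close> and \<open>v\<close> cuts the circle into the arcs from \<open>u\<close> to
  \<open>v\<close> and from \<open>v\<close> to \<open>u + 1\<close>. The predicates \<open>inward\<close> and \<open>outward\<close> tell which of them
  contains the image of \<open>u\<close>. The arcs are taken closed so that both predicates are closed conditions;
  they overlap only if \<open>u\<close> is mapped into its own class.\<close>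

definition inward :: "nat \<Rightarrow> real \<Rightarrow> real \<Rightarrow> bool" where
  "inward D u v \<longleftrightarrow> (\<exists>j::int. u \<le> real D * u - of_int j \<and> real D * u - of_int j \<le> v)"

definition outward :: "nat \<Rightarrow> real \<Rightarrow> real \<Rightarrow> bool" where
  "outward D u v \<longleftrightarrow> (\<exists>j::int. v \<le> real D * u - of_int j \<and> real D * u - of_int j \<le> u + 1)"

lemma closed_inward: "closed {p. inward D (fst p) (snd p)}"
proof -
  have "{p. inward D (fst p) (snd p)} =
      {p. \<exists>j::int. real D * fst p - snd p \<le> of_int j \<and> of_int j \<le> real D * fst p - fst p}"
    by (auto simp: inward_def le_diff_eq diff_le_eq add.commute)
  also have "closed \<dots>"
    by (intro closed_int_between continuous_intros)
  finally show ?thesis .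
qed

lemma closed_outward: "closed {p. outward D (fst p) (snd p)}"
proof -
  have "{p. outward D (fst p) (snd p)} =
      {p. \<exists>j::int. real D * fst p - (fst p + 1) \<le> of_int j \<and> of_int j \<le> real D * fst p - snd p}"
    by (auto simp: outward_def le_diff_eq diff_le_eq add.commute add.left_commute)
  also have "closed \<dots>"
    by (intro closed_int_between continuous_intros)
  finally show ?thesis .
qed

lemma inward_or_outward: "inward D u v \<or> outward D u v"
proof -
  define j where "j = \<lfloor>real D * u - u\<rfloor>"
  have "u \<le> real D * u - of_int j" "real D * u - of_int j \<le> u + 1" unfolding j_def by linarith+
  then show ?thesis unfolding inward_def outward_def by (meson linear)
qed

text \<open>The multiplier is a parameter because the property passes from \<open>d\<close> to its powers: what holds for
  the fixed classes of \<open>D\<close> then applies to the periodic classes of \<open>d\<close>.\<close>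

definition compatible :: "nat \<Rightarrow> bool" where
  "compatible D \<longleftrightarrow> D \<ge> 2 \<and> (\<forall>x y. E x y \<longrightarrow> E (real D * x) (real D * y)) \<and>
     (\<forall>x y. E (real D * x) y \<longrightarrow> (\<exists>z. E x z \<and> (\<exists>k::int. real D * z = y + of_int k)))"

lemma compatibleD:
  assumes "compatible D"
  shows "D \<ge> 2" "E x y \<Longrightarrow> E (real D * x) (real D * y)"
    "E (real D * x) y \<Longrightarrow> \<exists>z. E x z \<and> (\<exists>k::int. real D * z = y + of_int k)"
  using assms unfolding compatible_def by auto

lemma compatible_mult:
  assumes "compatible D" "compatible D'"
  shows "compatible (D * D')"
proof -
  have "D * D' \<ge> 2"
    using compatibleD(1)[OF assms(1)] compatibleD(1)[OF assms(2)]
    by (metis dual_order.trans mult_le_mono1 nat_mult_1 one_le_numeral)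
  moreover have "E (real (D * D') * x) (real (D * D') * y)" if "E x y" for x y
    using compatibleD(2)[OF assms(1) compatibleD(2)[OF assms(2) that]] by (simp add: mult_ac)
  moreover have "\<exists>z. E x z \<and> (\<exists>k::int. real (D * D') * z = y + of_int k)"
    if "E (real (D * D') * x) y" for x y
  proof -
    have "E (real D * (real D' * x)) y" using that by (simp add: mult_ac)
    then obtain z k where z: "E (real D' * x) z" "real D * z = y + of_int k"
      using compatibleD(3)[OF assms(1)] by blast
    then obtain w l where w: "E x w" "real D' * w = z + of_int l"
      using compatibleD(3)[OF assms(2)] by blast
    have "real (D * D') * w = real D * (real D' * w)" by simp
    also have "\<dots> = y + of_int (k + int D * l)" using w z by (simp add: algebra_simps)
    finally show ?thesis using w by blast
  qed
  ultimately show ?thesis unfolding compatible_def by blast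
qed

lemma compatible_power:
  assumes "compatible D" "n \<ge> 1"
  shows "compatible (D ^ n)"
  using assms(2) by (induction n rule: dec_induct) (simp_all add: assms(1) compatible_mult)

text \<open>If some angle of the image class lies inside the arc, then so does the image of \<open>u\<close> itself, and
  it cannot also be congruent to an angle in the complementary arc.\<close>

lemma image_inside_not_outward:
  assumes "E u v" "u < x" "x < v" "v < u + 1" "E x (real D * u)" "\<not> E u x"
  shows "\<not> outward D u v"
proof
  assume "outward D u v"
  then obtain j :: int where j: "v \<le> real D * u - of_int j" "real D * u - of_int j \<le> u + 1"
    unfolding outward_def by blast
  obtain k :: int where k: "u < real D * u - of_int k" "real D * u - of_int k < v"
    using class_in_arc[OF assms] by blast
  have "0 < real_of_int (k - j)" "real_of_int (k - j) < 1"
    using j k by (simp_all add: algebra_simps)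
  then show False by simp
qed

text \<open>Suppose that there is no such fixed class. Expansion then bounds the length of every arc of
  this kind from below by \<open>1 / (D + 1)\<close>: both end points are mapped into the open arc, hence the
  image of the arc wraps around the circle. So there is a shortest arc \<open>(u, v)\<close> that is mapped
  inward. Let \<open>e\<close> be the image of \<open>u\<close> in it. The pairs between \<open>(u, v)\<close> and the degenerate pair
  \<open>(e, e)\<close> change from inward to outward somewhere, and by minimality they do so at the class of
  \<open>u\<close>. That gives a pair of this class that still surrounds \<open>e\<close> and is mapped outward, although \<open>e\<close> is
  an angle of its image.\<close>

lemma inward_fixed_cut:
  assumes D: "compatible D" and "s < t" "t < s + 1" "E s t" "inward D s t"
  obtains u v where "s \<le> u" "u < v" "v \<le> t" "E u v" "E u (real D * u)"
proof (rule ccontr)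
  note witness = that
  assume "\<not> thesis"
  have nofix: "\<not> E u (real D * u)" if "s \<le> u" "u < v" "v \<le> t" "E u v" for u v
    using that witness \<open>\<not> thesis\<close> by blast
  have strict: "\<exists>i::int. u < real D * u - of_int i \<and> real D * u - of_int i < v"
    if uv: "s \<le> u" "u < v" "v \<le> t" "E u v" "inward D u v" for u v
  proof -
    obtain i :: int where i: "u \<le> real D * u - of_int i" "real D * u - of_int i \<le> v"
      using uv unfolding inward_def by blast
    have "real D * u - of_int i \<noteq> u" "real D * u - of_int i \<noteq> v"
      using nofix[OF uv(1-4)] shift_iff(2) uv(4) refl by metis+
    then have "u < real D * u - of_int i \<and> real D * u - of_int i < v" using i by simp
    then show ?thesis by blast
  qed
  \<comment> \<open>The images of the two end points differ by \<open>D * (v - u)\<close>; lifted to the arc \<open>(u, v)\<close>, they differ by less than \<open>v - u\<close>, so the lifts drop at least one full turn.\<close>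
  have long: "1 \<le> real (D + 1) * (v - u)"
    if uv: "s \<le> u" "u < v" "v \<le> t" "E u v" "inward D u v" for u v
  proof -
    obtain i :: int where i: "u < real D * u - of_int i" "real D * u - of_int i < v"
      using strict uv by blast
    moreover have "E (real D * u - of_int i) (real D * v)" using D uv compatibleD(2) by simp
    moreover have "\<not> E u (real D * u - of_int i)" using nofix uv by simp
    ultimately obtain j :: int where j: "u < real D * v - of_int j" "real D * v - of_int j < v"
      using class_in_arc[of u v "real D * u - of_int i" "real D * v"] uv assms(3) by auto
    have "j > i"
    proof (rule ccontr)
      assume "\<not> j > i"
      then have "real_of_int j \<le> i" by simp
      then have "real D * (v - u) < v - u"
        using i j by (simp add: algebra_simps)
      moreover have "real D * (v - u) \<ge> 1 * (v - u)"
        using compatibleD(1)[OF D] uv by (intro mult_right_mono) auto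
      ultimately show False by simp
    qed
    then have "real_of_int j \<ge> i + 1" by linarith
    then show ?thesis using i j by (simp add: algebra_simps)
  qed
  \<comment> \<open>The length bound keeps degenerate pairs out of the minimization.\<close>
  define G where "G = {p. inward D (fst p) (snd p)} \<inter> {p. 1 \<le> real (D + 1) * (snd p - fst p)}"
  have G: "closed G" unfolding G_def
    by (intro closed_Int closed_inward closed_Collect_le continuous_intros)
  define K where "K = ({s..t} \<times> {s..t}) \<inter> {p. E (fst p) (snd p)} \<inter> G"
  have Kpos: "x < y" if "(x, y) \<in> K" for x y
  proof -
    have "0 < real (D + 1) * (y - x)" using that by (auto simp: K_def G_def)
    then show ?thesis by (simp add: zero_less_mult_iff)
  qed
  have "compact K" unfolding K_def
    by (intro compact_Int_closed compact_Times closed_graph G) auto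
  moreover have "(s, t) \<in> K" using assms long[OF _ assms(2) _ assms(4,5)] by (simp add: K_def G_def)
  moreover have "continuous_on K (\<lambda>p. snd p - fst p)" by (intro continuous_intros)
  ultimately obtain p where p: "p \<in> K" "\<forall>q \<in> K. snd p - fst p \<le> snd q - fst q"
    using continuous_attains_inf[of K] by blast
  obtain u v where [simp]: "p = (u, v)" by force
  have uv: "s \<le> u" "v \<le> t" "E u v" "inward D u v" "(u, v) \<in> G" "u < v"
    using p(1) Kpos[of u v] by (simp_all add: K_def G_def)
  obtain i :: int where i: "u < real D * u - of_int i" "real D * u - of_int i < v"
    using strict[OF uv(1,6,2,3,4)] by blast
  define e where "e = real D * u - of_int i"
  have ne: "\<not> E u e" using nofix[OF uv(1,6,2,3)] by (simp add: e_def)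
  \<comment> \<open>The pair \<open>(e, e)\<close> counts as outward, since its outer arc is the whole circle.\<close>
  obtain x y x' y' where xy: "u \<le> x" "x \<le> x'" "x' \<le> e" "e \<le> y'" "y' \<le> y" "y \<le> v"
    "E x y" "E x x'" "E x y'" "(x, y) \<in> G" "(x', y') \<in> {p. outward D (fst p) (snd p)}"
  proof (rule crossing_pairs_equivalent[of u e e v G "{p. outward D (fst p) (snd p)}"])
    show "(a, b) \<in> G \<union> {p. outward D (fst p) (snd p)}"
      if "u \<le> a" "a \<le> e" "e \<le> b" "b \<le> v" "E a b" for a b
    proof (cases "inward D a b \<and> a < b")
      case True
      then show ?thesis using long[of a b] that uv by (auto simp: G_def)
    next
      case False
      have "outward D e e"
        unfolding outward_def by (rule exI[of _ "\<lfloor>real D * e - e\<rfloor>"]) linarith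
      moreover have "a = e \<and> b = e" if "\<not> a < b"
        using that \<open>a \<le> e\<close> \<open>e \<le> b\<close> by simp
      ultimately show ?thesis using False inward_or_outward[of D a b] by auto
    qed
    show "(e, e) \<in> {p. outward D (fst p) (snd p)}"
    proof -
      have "e \<le> real D * e - of_int \<lfloor>real D * e - e\<rfloor>" "real D * e - of_int \<lfloor>real D * e - e\<rfloor> \<le> e + 1" by linarith+
      then show ?thesis unfolding outward_def by auto
    qed
  qed (use uv i assms G closed_outward in \<open>auto simp: e_def\<close>)
  have "x < y" using xy(10) Kpos[of x y] xy uv i by (auto simp: K_def e_def)
  then have "(x, y) \<in> K" using xy uv by (auto simp: K_def)
  then have "v - u \<le> y - x" using bspec[OF p(2), of "(x, y)"] by simp
  then have "x = u" "y = v" using xy(1-6) by simp_all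
  then have "E u x'" "E u y'" using xy by auto
  then have "x' \<noteq> e" "y' \<noteq> e" using ne by auto
  then have lt: "x' < e" "e < y'" using xy by auto
  have x'y': "E x' y'" "\<not> E x' e" 
    using trans[OF sym[OF \<open>E u x'\<close>] \<open>E u y'\<close>] trans[OF \<open>E u x'\<close>, of e] ne by blast+
  have "E (real D * u) (real D * x')" using \<open>E u x'\<close> D compatibleD(2) by blast
  then have "E e (real D * x')" by (simp add: e_def)
  moreover have "y' < x' + 1" using xy uv assms by auto
  ultimately show False
    using image_inside_not_outward[OF x'y'(1) lt _ _ x'y'(2)] xy(11) by simp
qed

text \<open>The change from inward to outward takes place within one class. If that class is not fixed, its
  image lies in the gap to the left or to the right of the inner one of the two pairs, and that gap
  is an arc between equivalent angles that is mapped inward.\<close>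

lemma inward_outward_fixed_cut:
  assumes D: "compatible D" and ord: "s1 \<le> s2" "s2 < t2" "t2 \<le> t1" "t1 < s1 + 1"
    and E: "E s1 t1" "E s2 t2" and io: "inward D s1 t1" "outward D s2 t2"
  obtains u v where "u < v" "v < u + 1" "E u v" "E u (real D * u)" "u \<in> {s1..s2} \<union> {t2..t1}"
proof (rule ccontr)
  note witness = that
  assume "\<not> thesis"
  have nofix: "\<not> E u (real D * u)"
    if "u < v" "v < u + 1" "E u v" "u \<in> {s1..s2} \<union> {t2..t1}" for u v
    using that witness \<open>\<not> thesis\<close> by blast
  obtain s t s' t' where st: "s1 \<le> s" "s \<le> s'" "s' \<le> s2" "t2 \<le> t'" "t' \<le> t" "t \<le> t1"
    "E s t" "E s s'" "E s t'" "inward D s t" "outward D s' t'"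
  proof (rule crossing_pairs_equivalent[of s1 s2 t2 t1 "{p. inward D (fst p) (snd p)}"
        "{p. outward D (fst p) (snd p)}"])
    show "(a, b) \<in> {p. inward D (fst p) (snd p)} \<union> {p. outward D (fst p) (snd p)}" for a b
      using inward_or_outward by auto
  qed (use assms closed_inward closed_outward in auto)
  obtain j :: int where j: "s \<le> real D * s - of_int j" "real D * s - of_int j \<le> t"
    using st(10) unfolding inward_def by blast
  define x where "x = real D * s - of_int j"
  have ne: "\<not> E s x" using nofix[of s t] st ord by (simp add: x_def)
  have xs: "E x (real D * s)" by (simp add: x_def)
  have s't': "E s' t'" using trans[OF sym[OF st(8)] st(9)] .
  have t't: "E t' t" using trans[OF sym[OF st(9)] st(7)] .
  have ne': "\<not> E s' x" "\<not> E t' x" using ne trans[OF st(8)] trans[OF st(9)] by blast+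
  have xs': "E x (real D * s')" "E x (real D * t')"
    using trans[OF xs compatibleD(2)[OF D st(8)]] trans[OF xs compatibleD(2)[OF D st(9)]] by auto
  have neq: "x \<noteq> s'" "x \<noteq> t'" "x \<noteq> t" using ne st by auto
  have "x < s' \<or> (s' < x \<and> x < t') \<or> (t' < x \<and> x < t)"
    using neq j by (auto simp: x_def)
  then consider "x < s'" | "s' < x" "x < t'" | "t' < x" "x < t" by blast
  then show False
  proof cases
    case 1
    then have "inward D s s'" "s < s'" using j unfolding inward_def x_def by (blast intro: less_imp_le, simp)
    moreover have "s' < s + 1" using st ord by simp
    ultimately obtain u v where uv: "s \<le> u" "u < v" "v \<le> s'" "E u v" "E u (real D * u)"
      using inward_fixed_cut[OF D _ _ st(8)] by blast
    then show False using nofix[of u v] st ord by auto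
  next
    case 2
    moreover have "t' < s' + 1" using st ord by simp
    ultimately show False using image_inside_not_outward[OF s't' 2 _ xs'(1) ne'(1)] st(11) by simp
  next
    case 3
    have t: "t < t' + 1" using st ord by simp
    then have "\<exists>j::int. t' < real D * t' - j \<and> real D * t' - j < t"
      using class_in_arc[OF t't 3 _ xs'(2) ne'(2)] by simp
    then have "inward D t' t" unfolding inward_def by (meson less_imp_le)
    then obtain u v where uv: "t' \<le> u" "u < v" "v \<le> t" "E u v" "E u (real D * u)"
      using inward_fixed_cut[OF D _ t t't] 3 by (metis less_trans)
    then show False using nofix[of u v] st ord by auto
  qed
qed

text \<open>The angles \<open>a\<close>, \<open>b\<close> belong to one class, and \<open>(p, q)\<close>, \<open>(s, t)\<close> are angles of its images at the
  times \<open>n < m\<close>. Without periodic cut classes in the strip, a direction of motion is common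
  to nested chords in the strip. Hence it is inherited by multiples of a time: after time \<open>n\<close> the
  chord of \<open>a\<close> has become \<open>(p, q)\<close>, which moves inward just as \<open>(a, b)\<close> does; after time \<open>m - n\<close> the
  chord \<open>(p, q)\<close> has become \<open>(s, t)\<close>, which moves outward just as \<open>(p, q)\<close> does. The two
  conclusions disagree at time \<open>n * (m - n)\<close>.\<close>

lemma nested_returns_periodic_cut:
  assumes d: "compatible d" and nm: "1 \<le> n" "n < m"
    and ord: "a < s" "s < p" "p < q" "q < t" "t < b" "b < a + 1"
    and E: "E a b" "E s t" "E p q"
    and ret: "E p (real d ^ n * a)" "E s (real d ^ m * a)"
  obtains k u v where "1 \<le> k" "u < v" "v < u + 1" "E u v" "E u (real d ^ k * u)"
    "u \<in> {a..p} \<union> {q..b}"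
proof (rule ccontr)
  note witness = that
  assume "\<not> thesis"
  have nofix: "\<not> E u (real d ^ k * u)"
    if "1 \<le> k" "u < v" "v < u + 1" "E u v" "u \<in> {a..p} \<union> {q..b}" for k u v
    using that witness \<open>\<not> thesis\<close> by blast
  have map: "E (real d ^ k * x) (real d ^ k * y)" if "1 \<le> k" "E x y" for k x y
    using compatibleD(2)[OF compatible_power[OF d that(1)] that(2)] by simp
  have noclash: "\<not> (inward (d ^ k) x y \<and> outward (d ^ k) x' y')"
    if *: "1 \<le> k" "a \<le> x" "x \<le> x'" "x' \<le> p" "q \<le> y'" "y' \<le> y" "y \<le> b" "E x y" "E x' y'" for k x y x' y'
  proof
    assume io: "inward (d ^ k) x y \<and> outward (d ^ k) x' y'"
    have "x' < y'" "y < x + 1" using * ord by auto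
    then obtain u v where "u < v" "v < u + 1" "E u v" "E u (real (d ^ k) * u)" "u \<in> {x..x'} \<union> {y'..y}"
      using inward_outward_fixed_cut[OF compatible_power[OF d *(1)] *(3) _ *(6) _ *(8,9)] io by blast
    then show False using nofix[OF *(1), of u v] * by auto
  qed
  \<comment> \<open>The time that takes the class of \<open>p\<close> to the class of \<open>s\<close>.\<close>
  define k where "k = m - n"
  have k: "1 \<le> k" "m = k + n" using nm by (auto simp: k_def)
  have "E (real d ^ k * p) (real d ^ m * a)"
    using map[OF k(1) ret(1)] by (simp add: k(2) power_add mult.assoc)
  then have s_kp: "E s (real d ^ k * p)" using ret(2) sym trans by blast
  have "\<not> E p s"
  proof
    assume "E p s"
    from trans[OF this s_kp] show False using nofix[of k p q] k ord E by simp
  qed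
  have "\<not> E a p"
  proof
    assume "E a p"
    from trans[OF this ret(1)] show False using nofix[of n a b] nm ord E by simp
  qed
  have in_a: "inward (d ^ (l * n)) a b" if "1 \<le> l" for l
    using that
  proof (induction l rule: dec_induct)
    case base
    have "\<exists>j::int. a < real d ^ n * a - j \<and> real d ^ n * a - j < b"
      using class_in_arc[OF E(1) _ _ ord(6) ret(1) \<open>\<not> E a p\<close>] ord by simp
    then show ?case unfolding inward_def by (auto intro: less_imp_le)
  next
    case (step l)
    have ln: "1 \<le> l * n" "1 \<le> Suc l * n" using step(1) nm by auto
    have "inward (d ^ (l * n)) p q"
      using noclash[OF ln(1), of a p q b] step.IH inward_or_outward ord E by auto
    then obtain j :: int where j: "p \<le> real d ^ (l * n) * p - j" "real d ^ (l * n) * p - j \<le> q"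
      unfolding inward_def by auto
    define x where "x = real d ^ (l * n) * p - j"
    have "E (real d ^ (l * n) * p) (real d ^ (Suc l * n) * a)"
      using map[OF ln(1) ret(1)] by (simp add: power_add mult_ac)
    then have x: "E x (real d ^ (Suc l * n) * a)" by (simp add: x_def)
    have "\<not> E a x"
    proof
      assume "E a x"
      from trans[OF this x] show False using nofix[of "Suc l * n" a b] ln ord E by simp
    qed
    then have "\<exists>j::int. a < real d ^ (Suc l * n) * a - j \<and> real d ^ (Suc l * n) * a - j < b"
      using class_in_arc[OF E(1) _ _ ord(6) x] j ord by (simp add: x_def)
    then show ?case unfolding inward_def by (auto intro: less_imp_le)
  qed
  have out_arc: "outward D p q" if *: "q < x" "x < p + 1" "E x (real D * p)" "\<not> E p x" for D x
  proof -
    have "E q (p + 1)" "\<not> E q x" using E(3) sym[OF E(3)] that(4) trans[OF E(3)] by auto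
    then obtain j :: int where "q < real D * p - j" "real D * p - j < p + 1"
      using class_in_arc[OF _ *(1,2) _ *(3)] ord by auto
    then show ?thesis unfolding outward_def by (auto intro: less_imp_le)
  qed
  have out_p: "outward (d ^ (l * k)) p q" if "1 \<le> l" for l
    using that
  proof (induction l rule: dec_induct)
    case base
    show ?case
      using out_arc[of "s + 1" "d ^ k"] s_kp \<open>\<not> E p s\<close> ord by simp
  next
    case (step l)
    have lk: "1 \<le> l * k" "1 \<le> Suc l * k" using step(1) k by auto
    have "outward (d ^ (l * k)) s t"
      using noclash[OF lk(1), of s p q t] step.IH inward_or_outward ord E by auto
    then obtain j :: int where j: "t \<le> real d ^ (l * k) * s - j" "real d ^ (l * k) * s - j \<le> s + 1"
      unfolding outward_def by auto
    define x where "x = real d ^ (l * k) * s - j"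
    have "E (real d ^ (l * k) * s) (real d ^ (Suc l * k) * p)"
      using map[OF lk(1) s_kp] by (simp add: power_add mult_ac)
    then have x: "E x (real d ^ (Suc l * k) * p)" by (simp add: x_def)
    have "\<not> E p x"
    proof
      assume "E p x"
      from trans[OF this x] show False using nofix[of "Suc l * k" p q] lk ord E by simp
    qed
    then show ?case using out_arc[of x "d ^ (Suc l * k)"] x j ord by (simp add: x_def)
  qed
  have "1 \<le> k * n" using k nm by auto
  then show False
    using noclash[of "k * n" a p q b] in_a[OF k(1)] out_p[OF nm(1)] ord E by (simp add: mult.commute)
qed

section \<open>Recurrent classes are limits of periodic ones\<close>

lemma closed_class: "closed {y. E y c}"
proof -
  have "{y. E y c} = (\<lambda>y. (y, c)) -` {p. E (fst p) (snd p)}" by auto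
  moreover have "closed \<dots>"
    by (intro continuous_closed_vimage closed_graph continuous_intros)
  ultimately show ?thesis by simp
qed

text \<open>Approximation in the quotient, expressed by angles: a neighbourhood of the class of \<open>a\<close> contains
  an arc around every angle \<open>c\<close> of that class, so closeness to any one of them suffices.\<close>

definition limit_of_periodic_cuts :: "nat \<Rightarrow> real \<Rightarrow> bool" where
  "limit_of_periodic_cuts d a \<longleftrightarrow> (\<forall>\<epsilon>>0. \<exists>k u v. 1 \<le> k \<and> u < v \<and> v < u + 1 \<and> E u v \<and>
     E u (real d ^ k * u) \<and> (\<exists>c. E a c \<and> \<bar>u - c\<bar> < \<epsilon>))"

lemma one_sided_returns:
  assumes d: "compatible d" and ab: "a < b" "b < a + 1" "E a b"
    and aper: "\<And>k. 1 \<le> k \<Longrightarrow> \<not> E a (real d ^ k * a)"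
    and ret: "\<And>\<delta>. \<delta> > 0 \<Longrightarrow> \<exists>n p q. 1 \<le> n \<and> a < p \<and> p < a + \<delta> \<and> b - \<delta> < q \<and> q < b \<and>
      E p q \<and> E p (real d ^ n * a)"
    and "\<epsilon> > 0"
  shows "\<exists>k u v. 1 \<le> k \<and> u < v \<and> v < u + 1 \<and> E u v \<and> E u (real d ^ k * u) \<and>
    (\<bar>u - a\<bar> < \<epsilon> \<or> \<bar>u - b\<bar> < \<epsilon>)"
proof -
  have "min \<epsilon> ((b - a) / 2) > 0" using \<open>\<epsilon> > 0\<close> ab by simp
  from ret[OF this] obtain n p q where n: "1 \<le> n"
    and "a < p" "p < a + min \<epsilon> ((b - a) / 2)" "b - min \<epsilon> ((b - a) / 2) < q" "q < b"
    and E: "E p q" "E p (real d ^ n * a)"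
    by blast
  then have pq: "a < p" "p < a + \<epsilon>" "p < a + (b - a) / 2" "b - \<epsilon> < q" "b - (b - a) / 2 < q" "q < b"
    by linarith+
  then have "p < q" by (simp add: field_simps)
  \<comment> \<open>Returns this close to \<open>a\<close> happen only after time \<open>n\<close>.\<close>
  define U where "U = (\<Inter>i\<in>{1..n}. - {y. E y (real d ^ i * a)})"
  have "open U" unfolding U_def using closed_class by (intro open_INT) auto
  moreover have "a \<in> U" using aper by (auto simp: U_def)
  ultimately obtain r where r: "r > 0" "\<And>y. \<bar>y - a\<bar> < r \<Longrightarrow> y \<in> U"
    unfolding open_dist dist_real_def by metis
  have "min r (min (p - a) (b - q)) > 0" using r pq by simp
  from ret[OF this] obtain m s t where m: "1 \<le> m"
    and "a < s" "s < a + min r (min (p - a) (b - q))" "b - min r (min (p - a) (b - q)) < t" "t < b"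
    and E': "E s t" "E s (real d ^ m * a)"
    by blast
  then have st: "a < s" "s < a + r" "s < p" "q < t" "t < b" by linarith+
  have "s \<in> U" using st r(2)[of s] by simp
  have "n < m"
  proof (rule ccontr)
    assume "\<not> n < m"
    then have "m \<in> {1..n}" using m by simp
    then show False using \<open>s \<in> U\<close> E'(2) unfolding U_def by blast
  qed
  obtain k u v where *: "1 \<le> k" "u < v" "v < u + 1" "E u v" "E u (real d ^ k * u)"
    and u: "u \<in> {a..p} \<union> {q..b}"
    using nested_returns_periodic_cut[OF d n \<open>n < m\<close> st(1,3) \<open>p < q\<close> st(4,5) ab(2,3) E'(1) E(1,2) E'(2)]
    by blast
  have "\<bar>u - a\<bar> < \<epsilon> \<or> \<bar>u - b\<bar> < \<epsilon>" using u pq by auto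
  with * show ?thesis by blast
qed

text \<open>Returns come from one side of the chord of \<open>a\<close> and \<open>b\<close> arbitrarily closely, either from inside
  or from outside. The second case is the first one for the chord of \<open>b\<close> and \<open>a + 1\<close>.\<close>

lemma recurrent_cut_limit:
  assumes d: "compatible d" and ab: "a < b" "b < a + 1" "E a b"
    and ret: "\<And>\<delta>. \<delta> > 0 \<Longrightarrow> \<exists>n p q. 1 \<le> n \<and> \<bar>p - a\<bar> < \<delta> \<and> \<bar>q - b\<bar> < \<delta> \<and>
      E p q \<and> E p (real d ^ n * a)"
  shows "limit_of_periodic_cuts d a"
proof (cases "\<exists>k\<ge>1. E a (real d ^ k * a)")
  case True
  then obtain k where "1 \<le> k" "E a (real d ^ k * a)" by blast
  then show ?thesis unfolding limit_of_periodic_cuts_def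
    using ab by (intro allI impI exI[of _ k] exI[of _ a] exI[of _ b] conjI) simp_all
next
  case False
  then have aper: "\<not> E a (real d ^ k * a)" if "1 \<le> k" for k using that by blast
  have map: "E (real d ^ k * x) (real d ^ k * y)" if "1 \<le> k" "E x y" for k x y
    using compatibleD(2)[OF compatible_power[OF d that(1)] that(2)] by simp
  have aper': "\<not> E b (real d ^ k * b)" if "1 \<le> k" for k
    using aper[OF that] trans[OF trans[OF ab(3)] sym[OF map[OF that ab(3)]]] by blast
  define inner where "inner \<delta> \<longleftrightarrow> (\<exists>n p q. 1 \<le> n \<and> a < p \<and> p < a + \<delta> \<and> b - \<delta> < q \<and> q < b \<and>
      E p q \<and> E p (real d ^ n * a))" for \<delta>
  define outer where "outer \<delta> \<longleftrightarrow> (\<exists>n p q. 1 \<le> n \<and> b < p \<and> p < b + \<delta> \<and> (a + 1) - \<delta> < q \<and> q < a + 1 \<and>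
      E p q \<and> E p (real d ^ n * b))" for \<delta>
  have either: "inner \<delta> \<or> outer \<delta>" if "\<delta> > 0" for \<delta>
  proof -
    \<comment> \<open>So small that the integer translate of \<open>q\<close> provided by \<open>class_in_arc\<close> is \<open>q\<close> itself.\<close>
    define r where "r = min \<delta> (min (b - a) (a + 1 - b) / 2)"
    have "r > 0" using that ab by (simp add: r_def)
    have r: "r \<le> \<delta>" "r \<le> (b - a) / 2" "r \<le> (a + 1 - b) / 2"
      by (auto simp: r_def min_def field_simps)
    from ret[OF \<open>r > 0\<close>] obtain n p q where n: "1 \<le> n" and "\<bar>p - a\<bar> < r" "\<bar>q - b\<bar> < r"
      and E: "E p q" "E p (real d ^ n * a)" by blast
    then have pq: "\<bar>p - a\<bar> < \<delta>" "\<bar>q - b\<bar> < \<delta>" "\<bar>p - a\<bar> < (b - a) / 2" "\<bar>q - b\<bar> < (b - a) / 2"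
      "\<bar>p - a\<bar> < (a + 1 - b) / 2" "\<bar>q - b\<bar> < (a + 1 - b) / 2"
      using r by linarith+
    have ne: "\<not> E a p" using aper[OF n] E(2) trans by blast
    then have "p \<noteq> a" by auto
    then consider "a < p" | "p < a" by linarith
    then show ?thesis
    proof cases
      case 1
      then obtain j :: int where j: "a < q - j" "q - j < b"
        using class_in_arc[OF ab(3) 1 _ ab(2) E(1) ne] pq(3) by auto
      moreover have "q - b < (a + 1 - b) / 2" "b - q < (b - a) / 2" using pq(4,6) by linarith+
      then have "q - a < 1" "-1 < q - b" using ab(1,2) by (simp_all add: field_simps)
      ultimately have "real_of_int j < 1" "real_of_int j > -1" by linarith+
      then have "j = 0" by simp
      then have "inner \<delta>" unfolding inner_def using n 1 pq j E
        by (intro exI[of _ n] exI[of _ p] exI[of _ q]) auto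
      then show ?thesis ..
    next
      case 2
      have ba: "E b (a + 1)" "\<not> E b (p + 1)" "E (p + 1) q"
        using sym[OF ab(3)] trans[OF ab(3), of p] ne E(1) by auto
      have "a - p < (a + 1 - b) / 2" using pq(5) by linarith
      then have "b < p + 1" "p + 1 < a + 1" using 2 ab(2) by (simp_all add: field_simps)
      then obtain j :: int where j: "b < q - j" "q - j < a + 1"
        using class_in_arc[OF ba(1) _ _ _ ba(3,2)] ab by auto
      moreover have "q - b < (a + 1 - b) / 2" "b - q < (b - a) / 2" using pq(4,6) by linarith+
      then have "q - b < 1" "-1 < q - (a + 1)" using ab(1,2) by (simp_all add: field_simps)
      ultimately have "real_of_int j < 1" "real_of_int j > -1" by linarith+
      then have "j = 0" by simp
      moreover have "E q (real d ^ n * b)"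
        using trans[OF sym[OF E(1)] trans[OF E(2) map[OF n ab(3)]]] .
      moreover have "E q (p + 1)" using sym[OF E(1)] by simp
      ultimately have "outer \<delta>" unfolding outer_def using n 2 pq j
        by (intro exI[of _ n] exI[of _ q] exI[of _ "p + 1"]) auto
      then show ?thesis ..
    qed
  qed
  have mono: "inner \<delta> \<Longrightarrow> inner \<delta>'" "outer \<delta> \<Longrightarrow> outer \<delta>'" if "\<delta> \<le> \<delta>'" for \<delta> \<delta>'
  proof -
    have "p < c + \<delta> \<Longrightarrow> p < c + \<delta>'" "c - \<delta> < p \<Longrightarrow> c - \<delta>' < p" for p c using that by simp_all
    then show "inner \<delta> \<Longrightarrow> inner \<delta>'" "outer \<delta> \<Longrightarrow> outer \<delta>'"
      unfolding inner_def outer_def by blast+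
  qed
  have "(\<forall>\<delta>>0. inner \<delta>) \<or> (\<forall>\<delta>>0. outer \<delta>)"
  proof (rule ccontr)
    assume "\<not> ?thesis"
    then obtain x y where xy: "x > 0" "\<not> inner x" "y > 0" "\<not> outer y" by blast
    with either[of "min x y"] mono(1)[of "min x y" x] mono(2)[of "min x y" y] show False by auto
  qed
  then show ?thesis
  proof
    assume "\<forall>\<delta>>0. inner \<delta>"
    then have "\<exists>k u v. 1 \<le> k \<and> u < v \<and> v < u + 1 \<and> E u v \<and> E u (real d ^ k * u) \<and>
      (\<bar>u - a\<bar> < \<epsilon> \<or> \<bar>u - b\<bar> < \<epsilon>)" if "\<epsilon> > 0" for \<epsilon>
      using one_sided_returns[OF d ab aper _ that] unfolding inner_def by blast
    then show ?thesis unfolding limit_of_periodic_cuts_def using ab(3) refl[of a] by blast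
  next
    assume *: "\<forall>\<delta>>0. outer \<delta>"
    have ba: "E b (a + 1)" using sym[OF ab(3)] by simp
    have "\<exists>k u v. 1 \<le> k \<and> u < v \<and> v < u + 1 \<and> E u v \<and> E u (real d ^ k * u) \<and>
      (\<bar>u - b\<bar> < \<epsilon> \<or> \<bar>u - (a + 1)\<bar> < \<epsilon>)" if "\<epsilon> > 0" for \<epsilon>
    proof -
      have "a + 1 < b + 1" using ab(1) by simp
      moreover have "\<exists>n p q. 1 \<le> n \<and> b < p \<and> p < b + \<delta> \<and> (a + 1) - \<delta> < q \<and> q < a + 1 \<and>
        E p q \<and> E p (real d ^ n * b)" if "\<delta> > 0" for \<delta>
        using * that unfolding outer_def by blast
      ultimately show ?thesis using one_sided_returns[OF d ab(2) _ ba aper' _ that] by blast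
    qed
    moreover have "E a (a + 1)" by simp
    ultimately show ?thesis unfolding limit_of_periodic_cuts_def using ab(3) by blast
  qed
qed

text \<open>Any class with two angles is moved inward by one of its two arcs.\<close>

lemma exists_fixed_cut:
  assumes D: "compatible D"
  obtains u v where "u < v" "v < u + 1" "E u v" "E u (real D * u)"
proof -
  have "\<exists>a b. a < b \<and> b < a + 1 \<and> E a b"
  proof (cases "E 0 (1/2)")
    case True
    then show ?thesis by (intro exI[of _ 0] exI[of _ "1/2"]) auto
  next
    case False
    then obtain s t where "0 < s" "s < 1/2" "1/2 < t" "t < 0 + 1" "E s t"
      using separated[of 0 "1/2"] by auto
    then show ?thesis by (intro exI[of _ s] exI[of _ t]) auto
  qed
  then obtain a b where ab: "a < b" "b < a + 1" "E a b" by blast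
  have ba: "E b (a + 1)" using sym[OF ab(3)] by simp
  consider "E a (real D * a)" | "inward D a b" | "\<not> E a (real D * a)" "inward D b (a + 1)"
  proof (cases "inward D a b \<or> E a (real D * a)")
    case True
    then show ?thesis using that by blast
  next
    case False
    then have "outward D a b" using inward_or_outward by blast
    then obtain j :: int where j: "b \<le> real D * a - j" "real D * a - j \<le> a + 1"
      unfolding outward_def by blast
    define y where "y = real D * a - j"
    have y: "\<not> E a y" "E y (real D * a)" using False by (simp_all add: y_def)
    then have "y \<noteq> b" "y \<noteq> a + 1" "\<not> E b y" using ab(3) trans by auto
    moreover have "E y (real D * b)" using trans[OF y(2) compatibleD(2)[OF D ab(3)]] .
    ultimately have "\<exists>j::int. b < real D * b - j \<and> real D * b - j < a + 1"
      using class_in_arc[OF ba, of y] j ab by (simp add: y_def)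
    then have "inward D b (a + 1)" unfolding inward_def by (auto intro: less_imp_le)
    then show ?thesis using that False by blast
  qed
  then show thesis
  proof cases
    case 1
    then show ?thesis using that ab by blast
  next
    case 2
    obtain u v where "a \<le> u" "u < v" "v \<le> b" "E u v" "E u (real D * u)"
      using inward_fixed_cut[OF D ab 2] by blast
    then show ?thesis using that[of u v] ab by simp
  next
    case 3
    have "a + 1 < b + 1" using ab by simp
    then obtain u v where "b \<le> u" "u < v" "v \<le> a + 1" "E u v" "E u (real D * u)"
      using inward_fixed_cut[OF D ab(2) _ ba 3(2)] by blast
    then show ?thesis using that[of u v] ab by simp
  qed
qed

section \<open>A periodic class with a single angle\<close>

lemma finite_class_interval: "finite {y \<in> {l..h}. E x y}"
proof (rule finite_subset)
  show "{y \<in> {l..h}. E x y} \<subseteq>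
    (\<Union>k\<in>{\<lfloor>l - x\<rfloor>..\<lfloor>h - x\<rfloor>}. (\<lambda>y. y + of_int k) ` {y \<in> {x..<x+1}. E x y})"
  proof
    fix y assume y: "y \<in> {y \<in> {l..h}. E x y}"
    define k where "k = \<lfloor>y - x\<rfloor>"
    have "k \<in> {\<lfloor>l - x\<rfloor>..\<lfloor>h - x\<rfloor>}" using y by (auto simp: k_def intro!: floor_mono)
    moreover have "x \<le> y - k" "y - k < x + 1" unfolding k_def by linarith+
    then have "y \<in> (\<lambda>y. y + of_int k) ` {y \<in> {x..<x+1}. E x y}"
      using y by (intro image_eqI[of _ _ "y - k"]) auto
    ultimately show "y \<in> (\<Union>k\<in>{\<lfloor>l - x\<rfloor>..\<lfloor>h - x\<rfloor>}. (\<lambda>y. y + of_int k) ` {y \<in> {x..<x+1}. E x y})"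
      by blast
  qed
qed (use finite_class in auto)

text \<open>Two consecutive angles of a class, that is, one of the complementary arcs of the class.\<close>

definition adjacent :: "real \<Rightarrow> real \<Rightarrow> bool" where
  "adjacent s t \<longleftrightarrow> s < t \<and> t < s + 1 \<and> E s t \<and> (\<forall>x. s < x \<and> x < t \<longrightarrow> \<not> E s x)"

lemma adjacent_unique: "adjacent s t \<Longrightarrow> adjacent s t' \<Longrightarrow> t = t'"
  unfolding adjacent_def by (meson linorder_neqE_linordered_idom)

lemma adjacent_shift: "adjacent s t \<Longrightarrow> adjacent (s + of_int k) (t + of_int k)"
  unfolding adjacent_def
  by (auto simp: less_diff_eq[symmetric] diff_less_eq[symmetric])

lemma adjacent_exists:
  assumes "u < v" "v < u + 1" "E u v" "E u s"
  shows "\<exists>t. adjacent s t"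
proof -
  have "\<exists>y. s < y \<and> y < s + 1 \<and> E s y"
  proof -
    \<comment> \<open>At most one of \<open>u\<close>, \<open>v\<close> is congruent to \<open>s\<close>.\<close>
    define u' v' where "u' = u - of_int \<lfloor>u - s\<rfloor>" and "v' = v - of_int \<lfloor>v - s\<rfloor>"
    have *: "s \<le> u'" "u' < s + 1" "s \<le> v'" "v' < s + 1" unfolding u'_def v'_def by linarith+
    have "E s u'" "E s v'" using sym[OF assms(4)] trans[OF sym[OF assms(4)] assms(3)]
      by (simp_all add: u'_def v'_def)
    moreover have "u' \<noteq> s \<or> v' \<noteq> s"
    proof (rule ccontr)
      assume "\<not> ?thesis"
      then have "v - u = of_int (\<lfloor>v - s\<rfloor> - \<lfloor>u - s\<rfloor>)" by (simp add: u'_def v'_def)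
      then have "0 < real_of_int (\<lfloor>v - s\<rfloor> - \<lfloor>u - s\<rfloor>)" "real_of_int (\<lfloor>v - s\<rfloor> - \<lfloor>u - s\<rfloor>) < 1"
        using assms(1,2) by linarith+
      then show False by simp
    qed
    ultimately show ?thesis using * by (metis order_le_less)
  qed
  then obtain y where y: "s < y" "y < s + 1" "E s y" by blast
  define S where "S = {z \<in> {s..<s+1}. E s z} - {s}"
  have S: "finite S" "y \<in> S" using finite_class y by (auto simp: S_def)
  have "Min S \<in> S" using S by (intro Min_in) auto
  moreover have "\<not> E s x" if "s < x" "x < Min S" for x
  proof
    assume "E s x"
    then have "x \<in> S" using that \<open>Min S \<in> S\<close> by (auto simp: S_def)
    then show False using Min_le[OF S(1)] that by fastforce
  qed
  ultimately have "adjacent s (Min S)" unfolding adjacent_def by (auto simp: S_def)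
  then show ?thesis ..
qed

text \<open>The arc \<open>(u, w)\<close> is mapped homeomorphically onto the complementary arc \<open>(s, t)\<close> of a class. The class of
  the preimage of \<open>u'\<close> cannot leave the arc \<open>(u, w)\<close> and has to cover the class of \<open>u'\<close>, so
  it contains the only preimage of \<open>w'\<close> in that arc.\<close>

lemma pull_back_pair:
  assumes D: "compatible D" and "adjacent s t" "E u w"
    and im: "real D * u = s + of_int j" "real D * w = t + of_int j"
    and "s < u'" "u' < w'" "w' < t" "E u' w'"
  shows "u < (u' + of_int j) / real D" "(u' + of_int j) / real D < (w' + of_int j) / real D"
    "(w' + of_int j) / real D < w" "E ((u' + of_int j) / real D) ((w' + of_int j) / real D)"
proof -
  define v where "v = (u' + of_int j) / real D"
  have D2: "real D \<ge> 2" using compatibleD(1)[OF D] by simp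
  have Dv: "real D * v = u' + of_int j" using D2 by (simp add: v_def)
  have "s < w'" "u' < t" using assms by auto
  show uv: "u < (u' + of_int j) / real D" and "(u' + of_int j) / real D < (w' + of_int j) / real D"
    and "(w' + of_int j) / real D < w"
    using D2 im assms by (simp_all add: field_simps)
  then have vw: "u < v" "v < w" by (simp_all add: v_def)
  have st: "t < s + 1" "\<And>x. s < x \<Longrightarrow> x < t \<Longrightarrow> \<not> E s x" using assms(2) by (auto simp: adjacent_def)
  have "1 * (w - u) \<le> real D * (w - u)" using D2 vw by (intro mult_right_mono) auto
  also have "\<dots> < 1" using im st by (simp add: algebra_simps)
  finally have wu: "w < u + 1" by simp
  have nuv: "\<not> E u v"
  proof
    assume "E u v"
    from compatibleD(2)[OF D this] have "E s u'" by (simp add: im Dv)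
    then show False using st(2) assms by auto
  qed
  have "E (real D * v) w'" using assms by (simp add: Dv)
  then obtain z k where z: "E v z" "real D * z = w' + of_int k" using compatibleD(3)[OF D] by blast
  obtain i :: int where i: "u < z - i" "z - i < w"
    using class_in_arc[OF assms(3) vw wu z(1) nuv] by blast
  have "real D * u < real D * (z - i)" "real D * (z - i) < real D * w"
    using i D2 by simp_all
  then have "s + j < w' + of_int k - real D * i" "w' + of_int k - real D * i < t + j"
    using im z(2) by (simp_all add: right_diff_distrib)
  then have "real_of_int (k - int D * i - j) < 1" "real_of_int (k - int D * i - j) > -1"
    using st(1) assms by simp_all
  then have "k - int D * i - j = 0" by linarith
  then have "k = j + int D * i" by simp
  then have "real D * (z - i) = w' + of_int j"
    using z(2) by (simp add: right_diff_distrib)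
  then have "z - i = (w' + of_int j) / real D" using D2 by (simp add: field_simps)
  moreover have "E v (z - i)" using z(1) by simp
  ultimately show "E ((u' + of_int j) / real D) ((w' + of_int j) / real D)" by (simp add: v_def)
qed

text \<open>The complementary arc starting at \<open>s\<close> contains a smaller arc between equivalent angles that
  some iterate maps homeomorphically onto the complementary arc starting at \<open>s'\<close>. A self-covering
  arc contains a nested sequence of such arcs shrinking to a periodic angle.\<close>

definition covers :: "nat \<Rightarrow> real \<Rightarrow> real \<Rightarrow> bool" where
  "covers d s s' \<longleftrightarrow> (\<exists>n t t' u w. \<exists>j::int. 1 \<le> n \<and> adjacent s t \<and> adjacent s' t' \<and>
     s < u \<and> u < w \<and> w < t \<and> E u w \<and>
     real d ^ n * u = s' + of_int j \<and> real d ^ n * w = t' + of_int j)"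

lemma covers_trans:
  assumes d: "compatible d" and "covers d s s'" "covers d s' s''"
  shows "covers d s s''"
proof -
  obtain n t t' u w and j :: int where a: "1 \<le> n" "adjacent s t" "adjacent s' t'" "s < u" "u < w"
    "w < t" "E u w" "real d ^ n * u = s' + of_int j" "real d ^ n * w = t' + of_int j"
    using assms(2) unfolding covers_def by blast
  obtain m r t'' u' w' and i :: int where b: "1 \<le> m" "adjacent s' r" "adjacent s'' t''" "s' < u'"
    "u' < w'" "w' < r" "E u' w'" "real d ^ m * u' = s'' + of_int i" "real d ^ m * w' = t'' + of_int i"
    using assms(3) unfolding covers_def by blast
  have "r = t'" using a(3) b(2) adjacent_unique by blast
  define v z where "v = (u' + of_int j) / real (d ^ n)" and "z = (w' + of_int j) / real (d ^ n)"
  have vz: "u < v" "v < z" "z < w" "E v z"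
    using pull_back_pair[OF compatible_power[OF d a(1)] a(3,7) _ _ b(4,5) _ b(7)] a b(6) \<open>r = t'\<close>
    unfolding v_def z_def by auto
  have "real d ^ n \<noteq> 0" using compatibleD(1)[OF d] by simp
  then have "real d ^ n * v = u' + of_int j" "real d ^ n * z = w' + of_int j"
    by (simp_all add: v_def z_def)
  then have "real d ^ (m + n) * v = s'' + of_int (i + int d ^ m * j)"
    "real d ^ (m + n) * z = t'' + of_int (i + int d ^ m * j)"
    using b by (simp_all add: power_add mult.assoc distrib_left)
  moreover have "1 \<le> m + n" "s < v" "z < t" using a vz by auto
  ultimately show ?thesis unfolding covers_def using a(2) b(3) vz by blast
qed

text \<open>All classes that are mapped onto the class of \<open>s\<close> have at least two angles, and many of them lie
  inside the arc from \<open>s\<close> to \<open>t\<close>. Two equivalent preimages at minimal distance have no further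
  preimage between them, so the arc between them is mapped onto a single complementary arc.\<close>

lemma covers_serial:
  assumes d: "compatible d" and "adjacent s t"
  obtains s' where "covers d s s'" "E s s'"
proof -
  have st: "s < t" "t < s + 1" "E s t" "\<And>x. s < x \<Longrightarrow> x < t \<Longrightarrow> \<not> E s x"
    using assms(2) by (auto simp: adjacent_def)
  have "real d > 1" using compatibleD(1)[OF d] by simp
  then obtain n where n: "1 / (t - s) < real d ^ n" using real_arch_pow by blast
  have "1 / (t - s) > 1" using st by simp
  then have "1 \<le> n" using n by (cases n) auto
  define D where "D = d ^ n"
  have D: "compatible D" unfolding D_def using compatible_power[OF d \<open>1 \<le> n\<close>] .
  have D2: "real D \<ge> 2" using compatibleD(1)[OF D] by simp
  have Dst: "1 < real D * (t - s)" using n st by (simp add: D_def field_simps)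
  define X where "X = {x. s < x \<and> x < t \<and> E s (real D * x)}"
  have "X \<subseteq> (\<lambda>y. y / real D) ` {y \<in> {real D * s..real D * t}. E s y}"
  proof
    fix x assume "x \<in> X"
    then show "x \<in> (\<lambda>y. y / real D) ` {y \<in> {real D * s..real D * t}. E s y}"
      using D2 by (intro image_eqI[of _ _ "real D * x"]) (auto simp: X_def)
  qed
  then have finX: "finite X" using finite_class_interval finite_surj by blast
  \<comment> \<open>The class of \<open>x\<close> is mapped onto the class of \<open>s\<close>, which has two angles, so it has a second angle.\<close>
  have partner: "\<exists>x'. u < x' \<and> x' < w \<and> x' \<noteq> x \<and> E x x' \<and> E s (real D * x')"
    if *: "E u w" "u < x" "x < w" "w < u + 1" "\<not> E u x" "E s (real D * x)" for u w x
  proof -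
    have "\<exists>y. E s y \<and> y - real D * x \<notin> \<int>"
    proof (cases "s - real D * x \<in> \<int>")
      case True
      have "t - real D * x \<notin> \<int>"
      proof
        assume "t - real D * x \<in> \<int>"
        from Ints_diff[OF this True] have "t - s \<in> \<int>" by simp
        then obtain k :: int where "t - s = k" by (auto elim: Ints_cases)
        then have "0 < real_of_int k" "real_of_int k < 1" using st by linarith+
        then show False by simp
      qed
      then show ?thesis using st by blast
    next
      case False
      then show ?thesis using refl by blast
    qed
    then obtain y where y: "E s y" "y - real D * x \<notin> \<int>" by blast
    have "E (real D * x) y" using trans[OF sym[OF *(6)] y(1)] .
    then obtain z k where z: "E x z" "real D * z = y + of_int k" using compatibleD(3)[OF D] by blast
    obtain i :: int where i: "u < z - i" "z - i < w"
      using class_in_arc[OF *(1-4) z(1) *(5)] by blast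
    have Dz: "real D * (z - i) = y + of_int (k - int D * i)"
      using z(2) by (simp add: right_diff_distrib)
    have "z - i \<noteq> x"
    proof
      assume "z - i = x"
      then have "y - real D * x = of_int (int D * i - k)" using Dz by simp
      then show False using y(2) Ints_of_int by metis
    qed
    moreover have "E s (real D * (z - i))" unfolding Dz shift_iff(1) by (rule y(1))
    ultimately show ?thesis using i z(1) by (intro exI[of _ "z - i"]) simp
  qed
  define P where "P = {p \<in> X \<times> X. fst p < snd p \<and> E (fst p) (snd p)}"
  have "finite P" unfolding P_def using finX by simp
  moreover have "P \<noteq> {}"
  proof -
    \<comment> \<open>The first angle after \<open>s\<close> that is mapped to \<open>s\<close>.\<close>
    define x where "x = (s + of_int (\<lfloor>real D * s - s\<rfloor> + 1)) / real D"
    have Dx: "real D * x = s + of_int (\<lfloor>real D * s - s\<rfloor> + 1)" using D2 by (simp add: x_def)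
    then have "real D * s < real D * x" "real D * x \<le> real D * s + 1" by linarith+
    then have "real D * s < real D * x" "real D * x < real D * t" using Dst by (auto simp: right_diff_distrib)
    then have x: "s < x" "x < t" using D2 by auto
    have Ex: "E s (real D * x)" unfolding Dx by (rule shift)
    obtain x' where x': "s < x'" "x' < t" "x' \<noteq> x" "E x x'" "E s (real D * x')"
      using partner[OF st(3) x st(2) st(4)[OF x] Ex] by blast
    have "(x, x') \<in> P \<or> (x', x) \<in> P"
      using x x' Ex sym[OF x'(4)] by (auto simp: P_def X_def)
    then show ?thesis by blast
  qed
  ultimately obtain p where p: "p \<in> P" "\<And>q. q \<in> P \<Longrightarrow> snd p - fst p \<le> snd q - fst q"
    using ex_min_if_finite[of "(\<lambda>p. snd p - fst p) ` P"] by (auto simp: not_less)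
  obtain u w where [simp]: "p = (u, w)" by force
  have uw: "s < u" "u < w" "w < t" "E u w" "E s (real D * u)" "E s (real D * w)"
    using p(1) by (auto simp: P_def X_def)
  have none: "\<not> E s (real D * x)" if x: "u < x" "x < w" for x
  proof
    assume Ex: "E s (real D * x)"
    have min: "w - u \<le> b - a" if "a < b" "u \<le> a" "b \<le> w" "E a b" "E s (real D * a)" "E s (real D * b)" for a b
      using p(2)[of "(a, b)"] that uw by (auto simp: P_def X_def)
    show False
    proof (cases "E u x")
      case True
      then show False using min[of u x] x uw Ex by simp
    next
      case False
      have "w < u + 1" using uw st by simp
      then obtain x' where x': "u < x'" "x' < w" "x' \<noteq> x" "E x x'" "E s (real D * x')"
        using partner[OF uw(4) x _ False Ex] by blast
      then consider "x < x'" | "x' < x" by linarith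
      then show False
        using min[of x x'] min[of x' x] x x' Ex sym[OF x'(4)] by cases auto
    qed
  qed
  have noneD: "\<not> E (real D * u) y" if y: "real D * u < y" "y < real D * w" for y
  proof
    assume "E (real D * u) y"
    then have "E s (real D * (y / real D))" using trans[OF uw(5)] D2 by simp
    moreover have "u < y / real D" "y / real D < w" using y D2 by (simp_all add: field_simps)
    ultimately show False using none by blast
  qed
  obtain r where r: "adjacent (real D * u) r" using adjacent_exists[OF st(1-3) uw(5)] by blast
  have "real D * u < real D * w" using uw D2 by simp
  moreover have "E (real D * u) (real D * w)" using compatibleD(2)[OF D uw(4)] .
  moreover have "real D * w < real D * u + 1"
    using r noneD[of r] unfolding adjacent_def by fastforce
  ultimately have "adjacent (real D * u) (real D * w)" unfolding adjacent_def using noneD by blast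
  then have "covers d s (real D * u)"
    unfolding covers_def using \<open>1 \<le> n\<close> assms(2) uw
    by (intro exI[of _ n] exI[of _ t] exI[of _ "real D * w"] exI[of _ u] exI[of _ w] exI[of _ "0::int"])
      (simp add: D_def)
  then show thesis using that uw(5) by blast
qed

lemma covers_shift:
  assumes "covers d s s'" shows "covers d s (s' + of_int k)"
proof -
  obtain n t t' u w and j :: int where a: "1 \<le> n" "adjacent s t" "adjacent s' t'" "s < u" "u < w"
    "w < t" "E u w" "real d ^ n * u = s' + of_int j" "real d ^ n * w = t' + of_int j"
    using assms unfolding covers_def by blast
  have "real d ^ n * u = s' + of_int k + of_int (j - k)" "real d ^ n * w = t' + of_int k + of_int (j - k)"
    using a by simp_all
  then show ?thesis unfolding covers_def using a adjacent_shift[OF a(3), of k] by blast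
qed

text \<open>A class has finitely many complementary arcs, and a serial transitive relation on a finite set
  has a reflexive point.\<close>

lemma exists_self_cover:
  assumes d: "compatible d"
  obtains s where "covers d s s"
proof -
  obtain a b where ab: "a < b" "b < a + 1" "E a b" using exists_fixed_cut[OF d] by blast
  define F where "F = {y \<in> {a..<a+1}. E a y}"
  have F: "finite F" "F \<noteq> {}" using finite_class ab by (auto simp: F_def)
  have serial: "\<exists>s'\<in>F. covers d s s'" if "s \<in> F" for s
  proof -
    have Es: "E a s" using that by (simp add: F_def)
    then obtain t where "adjacent s t" using adjacent_exists[OF ab] by blast
    then obtain s' where s': "covers d s s'" "E s s'" using covers_serial[OF d] by blast
    define k where "k = \<lfloor>s' - a\<rfloor>"
    have "a \<le> s' - k" "s' - k < a + 1" unfolding k_def by linarith+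
    moreover have "E a (s' - k)" using trans[OF Es s'(2)] by simp
    moreover have "covers d s (s' - k)" using covers_shift[OF s'(1), of "- k"] by simp
    ultimately show ?thesis by (intro bexI[of _ "s' - k"]) (auto simp: F_def)
  qed
  have "\<exists>s\<in>F. covers d s s"
  proof (rule ccontr)
    assume irr: "\<not> ?thesis"
    have "transp_on F (covers d)" using covers_trans[OF d] by (auto intro: transp_onI)
    moreover have "asymp_on F (covers d)" using irr covers_trans[OF d] by (auto intro!: asymp_onI)
    ultimately obtain m where "m \<in> F" "\<forall>x\<in>F. m \<noteq> x \<longrightarrow> \<not> covers d m x"
      using Finite_Set.bex_max_element[OF F(1) _ _ F(2)] by metis
    then show False using serial irr by metis
  qed
  then show thesis using that by blast
qed

text \<open>Iterating the inverse branch of a self-covering yields chords that shrink to its fixed angle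
  \<open>\<theta>\<close> from both sides. An angle equivalent to \<open>\<theta>\<close> would have to cross them, which would put
  \<open>\<theta>\<close> into the class whose complementary arc contains it.\<close>

lemma exists_periodic_singleton:
  assumes d: "compatible d"
  obtains \<theta> n where "1 \<le> n" "real d ^ n * \<theta> - \<theta> \<in> \<int>" "\<And>y. E \<theta> y \<Longrightarrow> y - \<theta> \<in> \<int>"
proof -
  obtain s where "covers d s s" using exists_self_cover[OF d] by blast
  then obtain n t t' u w and j :: int where a: "1 \<le> n" "adjacent s t" "adjacent s t'" "s < u" "u < w"
    "w < t" "E u w" "real d ^ n * u = s + of_int j" "real d ^ n * w = t' + of_int j"
    unfolding covers_def by blast
  have [simp]: "t' = t" using adjacent_unique a by blast
  define D where "D = d ^ n"
  have D: "compatible D" unfolding D_def using compatible_power[OF d a(1)] .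
  have D2: "real D \<ge> 2" using compatibleD(1)[OF D] by simp
  have im: "real D * u = s + of_int j" "real D * w = t + of_int j" using a by (simp_all add: D_def)
  \<comment> \<open>The fixed point of the inverse branch \<open>x \<mapsto> (x + j) / D\<close>, whose iterates are \<open>h k\<close>.\<close>
  define \<theta> where "\<theta> = of_int j / (real D - 1)"
  have fixD: "real D * \<theta> = \<theta> + of_int j" using D2 by (simp add: \<theta>_def field_simps)
  have "real D * s < s + of_int j" "t + of_int j < real D * t"
    using im a(4,6) D2 by (simp_all add: im[symmetric])
  then have \<theta>: "s < \<theta>" "\<theta> < t" using D2 by (simp_all add: \<theta>_def field_simps)
  have fixk: "\<exists>i::int. real D ^ k * \<theta> = \<theta> + i" for k
  proof (induction k)
    case (Suc k)
    then obtain i :: int where "real D ^ k * \<theta> = \<theta> + i" by blast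
    then have "real D ^ Suc k * \<theta> = \<theta> + of_int (j + int D * i)"
      using fixD by (simp add: mult.assoc distrib_left)
    then show ?case by blast
  qed auto
  define h where "h k x = \<theta> + (x - \<theta>) / real D ^ k" for k x
  have hs: "h (Suc k) x = (h k x + of_int j) / real D" for k x
  proof -
    have "(h k x + of_int j) / real D = (real D * \<theta> + (x - \<theta>) / real D ^ k) / real D"
      using fixD by (simp add: h_def)
    also have "\<dots> = \<theta> + (x - \<theta>) / real D ^ k / real D"
      using D2 by (simp add: add_divide_distrib)
    finally show ?thesis by (simp add: h_def mult.commute)
  qed
  have Dk: "real D ^ k > 1" if "1 \<le> k" for k using that D2 by (intro one_less_power) auto
  have "s < h k s \<and> h k s < \<theta> \<and> \<theta> < h k t \<and> h k t < t" if "1 \<le> k" for k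
  proof -
    have "(\<theta> - s) / real D ^ k < \<theta> - s" "(t - \<theta>) / real D ^ k < t - \<theta>"
      using Dk[OF that] \<theta> by (simp_all add: divide_less_eq)
    moreover have "0 < (\<theta> - s) / real D ^ k" "0 < (t - \<theta>) / real D ^ k"
      using D2 \<theta> by (simp_all add: zero_less_divide_iff)
    moreover have "h k s = \<theta> - (\<theta> - s) / real D ^ k" "h k t = \<theta> + (t - \<theta>) / real D ^ k"
      using D2 by (simp_all add: h_def field_simps)
    ultimately show ?thesis by linarith
  qed note between = this
  have Eh: "E (h k s) (h k t)" if "1 \<le> k" for k
    using that
  proof (induction k rule: dec_induct)
    case base
    have "h 1 s = u" "h 1 t = w" using hs[of 0] im D2 by (simp_all add: h_def field_simps)
    then show ?case using a by simp
  next
    case (step k)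
    have b: "s < h k s" "h k s < h k t" "h k t < t" using between[OF step(1)] by linarith+
    show ?case
      unfolding hs using pull_back_pair(4)[OF D a(2,7) im b step.IH] .
  qed
  have single: "y - \<theta> \<in> \<int>" if "E \<theta> y" for y
  proof (rule ccontr)
    assume "y - \<theta> \<notin> \<int>"
    define y' where "y' = y - of_int \<lfloor>y - \<theta>\<rfloor>"
    have "y' \<noteq> \<theta>"
    proof
      assume "y' = \<theta>"
      then have "y - \<theta> = of_int \<lfloor>y - \<theta>\<rfloor>" by (simp add: y'_def)
      then show False using \<open>y - \<theta> \<notin> \<int>\<close> Ints_of_int by metis
    qed
    moreover have "\<theta> \<le> y'" "y' < \<theta> + 1" unfolding y'_def by linarith+
    ultimately have y': "\<theta> < y'" "y' < \<theta> + 1" "E \<theta> y'" using that by (auto simp: y'_def)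
    define r where "r = min (y' - \<theta>) (\<theta> + 1 - y')"
    have "r > 0" using y' by (simp add: r_def)
    obtain k where k: "1 / r < real D ^ k" using real_arch_pow[of "real D"] D2 by auto
    have "1 / r > 1" using y' \<open>r > 0\<close> by (auto simp: r_def min_def field_simps)
    then have "1 \<le> k" using k by (cases k) auto
    have "1 / real D ^ k < r" using k \<open>r > 0\<close> D2 by (simp add: field_simps)
    moreover have "(\<theta> - s) / real D ^ k \<le> 1 / real D ^ k" "(t - \<theta>) / real D ^ k \<le> 1 / real D ^ k"
      using \<theta> a(2) D2 by (intro divide_right_mono; simp add: adjacent_def)+
    moreover have "h k s = \<theta> - (\<theta> - s) / real D ^ k" "h k t = \<theta> + (t - \<theta>) / real D ^ k"
      using D2 by (simp_all add: h_def field_simps)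
    ultimately have "h k t < y'" "y' < h k s + 1" by (auto simp: r_def)
    then have "E (h k s) \<theta>"
      using unlinked[of "h k s" \<theta> "h k t" y'] between[OF \<open>1 \<le> k\<close>] Eh[OF \<open>1 \<le> k\<close>] y'(3) by blast
    then have "E (real D ^ k * h k s) (real D ^ k * \<theta>)"
      using compatibleD(2)[OF compatible_power[OF D \<open>1 \<le> k\<close>]] by simp
    moreover obtain i :: int where i: "real D ^ k * \<theta> = \<theta> + i" using fixk by blast
    moreover have "real D ^ k * h k s = s + of_int i"
      using i D2 by (simp add: h_def distrib_left)
    ultimately have "E s \<theta>" by simp
    then show False using \<theta> a(2) by (auto simp: adjacent_def)
  qed
  have "real d ^ n * \<theta> - \<theta> = of_int j" using fixD by (simp add: D_def)
  then have "real d ^ n * \<theta> - \<theta> \<in> \<int>" by simp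
  then show thesis using that a(1) single by blast
qed

end

section \<open>The circle, its chords, and separation in dendrites\<close>

definition ang :: "real \<Rightarrow> complex" where
  "ang x = cis (2 * pi * x)"

lemma continuous_on_ang [continuous_intros]:
  "continuous_on S f \<Longrightarrow> continuous_on S (\<lambda>x. ang (f x))"
  unfolding ang_def by (intro continuous_intros)

lemma norm_ang [simp]: "norm (ang x) = 1"
  by (simp add: ang_def)

lemma ang_in_circle [simp]: "ang x \<in> unit_circle"
  by (simp add: dist_norm)

lemma ang_eq_iff: "ang x = ang y \<longleftrightarrow> x - y \<in> \<int>"
proof
  assume "ang x = ang y"
  then have "sin (2 * pi * x) = sin (2 * pi * y) \<and> cos (2 * pi * x) = cos (2 * pi * y)"
    by (simp add: ang_def complex_eq_iff)
  then obtain n :: int where "2 * pi * x = 2 * pi * y + 2 * pi * n"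
    unfolding sin_cos_eq_iff by blast
  then have "2 * pi * x = 2 * pi * (y + n)" by (simp add: distrib_left)
  then have "x - y = n" by simp
  then show "x - y \<in> \<int>" by simp
next
  assume "x - y \<in> \<int>"
  then have "cis (2 * pi * (x - y)) = 1" by (rule cis_multiple_2pi)
  then have "cis (2 * pi * (x - y)) * ang y = ang y" by simp
  then show "ang x = ang y" by (simp add: ang_def cis_mult right_diff_distrib)
qed

lemma ang_shift [simp]: "ang (x + of_int k) = ang x" "ang (x - of_int k) = ang x" "ang (x + 1) = ang x"
  by (simp_all add: ang_eq_iff)

lemma ang_cases:
  assumes "z \<in> unit_circle"
  obtains x where "z = ang x" "a \<le> x" "x < a + 1"
proof -
  have "z \<noteq> 0" "norm z = 1" using assms by (auto simp: dist_norm)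
  then have "cis (Arg z) = z" by (simp add: cis_Arg sgn_eq)
  then have z: "z = ang (Arg z / (2 * pi))" by (simp add: ang_def)
  define y where "y = Arg z / (2 * pi)"
  have "ang (y - of_int \<lfloor>y - a\<rfloor>) = z" using z by (simp add: y_def[symmetric])
  moreover have "a \<le> y - of_int \<lfloor>y - a\<rfloor>" "y - of_int \<lfloor>y - a\<rfloor> < a + 1" by linarith+
  ultimately show thesis using that by metis
qed

lemma ang_power: "ang x ^ d = ang (real d * x)"
  unfolding ang_def Complex.DeMoivre by (simp add: mult_ac)

text \<open>Rotate so that the chord from \<open>a\<close> to \<open>b\<close> becomes vertical. The points \<open>c\<close> and \<open>e\<close> lie on
  different sides of the vertical line through it, so the other chord meets this line, in a point
  inside the open disc; the part of the line in the open disc is the open chord.\<close>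

lemma crossing_chords_meet:
  assumes "a < c" "c < b" "b < e" "e < a + 1"
  shows "open_segment (ang a) (ang b) \<inter> open_segment (ang c) (ang e) \<noteq> {}"
proof -
  define m \<phi> where "m = (a + b) / 2" and "\<phi> = pi * (b - a)"
  have \<phi>: "0 < \<phi>" "\<phi> < pi" using assms by (simp_all add: \<phi>_def)
  \<comment> \<open>The rotation that makes the chord from \<open>a\<close> to \<open>b\<close> vertical, with real part \<open>cos \<phi>\<close>.\<close>
  define \<omega> where "\<omega> = cis (- (2 * pi * m))"
  have rot: "\<omega> * ang x = cis (2 * pi * (x - m))" for x
    by (simp add: \<omega>_def ang_def cis_mult right_diff_distrib)
  have ab: "\<omega> * ang a = cis (- \<phi>)" "\<omega> * ang b = cis \<phi>"
    unfolding rot by (rule arg_cong[of _ _ cis], simp add: m_def \<phi>_def field_simps)+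
  have c: "cos \<phi> < cos (2 * pi * (c - m))"
  proof -
    have "2 * \<bar>c - m\<bar> < b - a" using assms unfolding m_def by (simp add: abs_if field_simps)
    then have "pi * (2 * \<bar>c - m\<bar>) < \<phi>" unfolding \<phi>_def by (intro mult_strict_left_mono) auto
    then have "cos \<phi> < cos (pi * (2 * \<bar>c - m\<bar>))"
      using \<phi> by (intro cos_monotone_0_pi) auto
    also have "pi * (2 * \<bar>c - m\<bar>) = \<bar>2 * pi * (c - m)\<bar>" by (simp add: abs_mult)
    finally show ?thesis by simp
  qed
  have e: "cos (2 * pi * (e - m)) < cos \<phi>"
  proof -
    have "b - a < 2 * (e - m)" "2 * (e - m) < 2 - (b - a)" using assms by (simp_all add: m_def field_simps)
    then have "pi * (b - a) < pi * (2 * (e - m))" "pi * (2 * (e - m)) < pi * (2 - (b - a))"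
      by (simp_all only: mult_less_cancel_left_pos pi_gt_zero)
    then have *: "\<phi> < 2 * pi * (e - m)" "2 * pi * (e - m) < 2 * pi - \<phi>"
      by (simp_all add: \<phi>_def algebra_simps)
    show ?thesis
    proof (cases "2 * pi * (e - m) \<le> pi")
      case True
      then show ?thesis using * \<phi> by (intro cos_monotone_0_pi) auto
    next
      case False
      have "cos (2 * pi - 2 * pi * (e - m)) < cos \<phi>"
        using * \<phi> False by (intro cos_monotone_0_pi) auto
      then show ?thesis by (simp add: cos_diff)
    qed
  qed
  define C S where "C = cos (2 * pi * (c - m))" and "S = cos (2 * pi * (e - m))"
  \<comment> \<open>The parameter at which the chord from \<open>c\<close> to \<open>e\<close> has real part \<open>cos \<phi>\<close>.\<close>
  define u where "u = (C - cos \<phi>) / (C - S)"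
  have u: "0 < u" "u < 1" using c e by (auto simp: u_def C_def S_def field_simps)
  have uC: "u * (C - S) = C - cos \<phi>" using c e by (simp add: u_def C_def S_def)
  define P where "P = (1 - u) *\<^sub>R ang c + u *\<^sub>R ang e"
  have "e - c \<notin> \<int>"
  proof
    assume "e - c \<in> \<int>"
    then obtain k :: int where "e - c = k" by (auto elim: Ints_cases)
    then have "0 < real_of_int k" "real_of_int k < 1" using assms by linarith+
    then show False by simp
  qed
  then have "ang c \<noteq> ang e" by (metis ang_eq_iff)
  then have P: "P \<in> open_segment (ang c) (ang e)" using u by (auto simp: in_segment P_def)
  then have "norm P < 1" using dist_decreases_open_segment[OF P, of 0] by simp
  have "Re (\<omega> * P) = (1 - u) * C + u * S"
    unfolding P_def distrib_left mult_scaleR_right rot by (simp add: C_def S_def)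
  also have "\<dots> = cos \<phi>" using uC by (simp add: algebra_simps)
  finally have Re: "Re (\<omega> * P) = cos \<phi>" .
  define y where "y = Im (\<omega> * P)"
  have "norm (\<omega> * P) < 1" using \<open>norm P < 1\<close> by (simp add: norm_mult \<omega>_def)
  then have "(norm (\<omega> * P))\<^sup>2 < 1" by (simp add: power_less_one_iff)
  then have "(cos \<phi>)\<^sup>2 + y\<^sup>2 < 1" by (simp only: cmod_power2 Re y_def)
  moreover have "(cos \<phi>)\<^sup>2 + (sin \<phi>)\<^sup>2 = 1" by simp
  ultimately have "y\<^sup>2 < (sin \<phi>)\<^sup>2" by linarith
  moreover have sin: "sin \<phi> > 0" using \<phi> by (simp add: sin_gt_zero)
  ultimately have "\<bar>y\<bar> < sin \<phi>" using power2_less_imp_less[of "\<bar>y\<bar>" "sin \<phi>"] by simp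
  then have y: "y < sin \<phi>" "- sin \<phi> < y" by auto
  define v where "v = (y + sin \<phi>) / (2 * sin \<phi>)"
  have v: "0 < v" "v < 1" using y sin by (simp_all add: v_def field_simps)
  have "v * (2 * sin \<phi>) = y + sin \<phi>" using sin by (simp add: v_def)
  then have "\<omega> * P = (1 - v) *\<^sub>R cis (- \<phi>) + v *\<^sub>R cis \<phi>"
    using Re by (simp add: complex_eq_iff y_def algebra_simps)
  also have "\<dots> = \<omega> * ((1 - v) *\<^sub>R ang a + v *\<^sub>R ang b)"
    unfolding distrib_left mult_scaleR_right ab ..
  finally have "P = (1 - v) *\<^sub>R ang a + v *\<^sub>R ang b" by (simp add: \<omega>_def)
  moreover have "ang a \<noteq> ang b"
  proof
    assume "ang a = ang b"
    then have "cis (- \<phi>) = cis \<phi>" using ab by simp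
    then show False using sin by (simp add: complex_eq_iff)
  qed
  ultimately have "P \<in> open_segment (ang a) (ang b)" using v by (auto simp: in_segment)
  with P show ?thesis by blast
qed

text \<open>Kuratowski's embedding by distance functions. The real line, which parametrizes the space,
  serves as the domain of these functions. The target is a Banach space, where paths are known to
  contain arcs.\<close>

lemma embedding_in_bounded_functions:
  fixes X :: "'a topology" and \<gamma> :: "real \<Rightarrow> 'a"
  assumes "metrizable_space X" "compact_space X"
    and \<gamma>: "continuous_map euclidean X \<gamma>" "range \<gamma> = topspace X"
  obtains \<Phi> :: "'a \<Rightarrow> (real \<Rightarrow>\<^sub>C real)" where "continuous_map X euclidean \<Phi>" "inj_on \<Phi> (topspace X)"
proof -
  obtain M d where "Metric_space M d" and X: "X = Metric_space.mtopology M d"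
    using assms(1) unfolding metrizable_space_def by blast
  then interpret Metric_space M d by simp
  have M: "topspace X = M" by (simp add: X)
  have \<gamma>M: "\<gamma> t \<in> M" for t using \<gamma>(2) M by auto
  have "compactin mtopology M" using assms(2) by (simp add: X compact_space_def)
  then obtain B where B: "\<And>x y. x \<in> M \<Longrightarrow> y \<in> M \<Longrightarrow> d x y \<le> B"
    using compactin_imp_mbounded mbounded_alt by meson
  have lip: "\<bar>d x z - d y z\<bar> \<le> d x y" if "x \<in> M" "y \<in> M" "z \<in> M" for x y z
    using triangle[of x y z] triangle[of y x z] that commute[of x y] by auto
  have lip2: "\<bar>d x z - d x y\<bar> \<le> d y z" if "x \<in> M" "y \<in> M" "z \<in> M" for x y z
    using lip[of z y x] that commute by metis
  have mem: "(\<lambda>t. d g (\<gamma> t)) \<in> bcontfun" if g: "g \<in> M" for g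
  proof -
    have "isCont (\<lambda>t. d g (\<gamma> t)) t" for t
      unfolding isCont_def LIM_def
    proof (intro allI impI)
      fix r :: real assume "r > 0"
      have "openin euclidean {s. \<gamma> s \<in> mball (\<gamma> t) r}"
        using openin_continuous_map_preimage[OF \<gamma>(1), of "mball (\<gamma> t) r"] by (simp add: X)
      then have "open {s. \<gamma> s \<in> mball (\<gamma> t) r}" by simp
      moreover have "t \<in> {s. \<gamma> s \<in> mball (\<gamma> t) r}" using \<open>r > 0\<close> \<gamma>M by simp
      ultimately obtain \<delta> where \<delta>: "\<delta> > 0" "\<And>s. dist s t < \<delta> \<Longrightarrow> \<gamma> s \<in> mball (\<gamma> t) r"
        unfolding open_dist by blast
      have "dist (d g (\<gamma> s)) (d g (\<gamma> t)) < r" if "dist s t < \<delta>" for s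
        using \<delta>(2)[OF that] lip2[OF g \<gamma>M \<gamma>M, of s t] by (simp add: dist_real_def)
      then show "\<exists>\<delta>>0. \<forall>s. s \<noteq> t \<and> dist s t < \<delta> \<longrightarrow> dist (d g (\<gamma> s)) (d g (\<gamma> t)) < r"
        using \<delta>(1) by blast
    qed
    then have "continuous_on UNIV (\<lambda>t. d g (\<gamma> t))" by (simp add: continuous_on_eq_continuous_at)
    moreover have "bounded (range (\<lambda>t. d g (\<gamma> t)))"
      unfolding bounded_iff using B[OF g \<gamma>M] nonneg by (intro exI[of _ B]) auto
    ultimately show ?thesis by (simp add: bcontfun_def)
  qed
  define \<Phi> where "\<Phi> g = Bcontfun (\<lambda>t. d g (\<gamma> t))" for g
  have app: "apply_bcontfun (\<Phi> g) t = d g (\<gamma> t)" if "g \<in> M" for g t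
    using mem[OF that] by (simp add: \<Phi>_def Bcontfun_inverse)
  have contr: "dist (\<Phi> g) (\<Phi> h) \<le> d g h" if "g \<in> M" "h \<in> M" for g h
    using that lip \<gamma>M by (intro dist_bound) (simp add: app dist_real_def)
  have "continuous_map mtopology Met_TC.mtopology \<Phi>"
    unfolding metric_continuous_map[OF Met_TC.Metric_space_axioms]
  proof (intro conjI ballI allI impI)
    fix g and r :: real assume "g \<in> M" "r > 0"
    then show "\<exists>\<delta>>0. \<forall>h. h \<in> M \<and> d g h < \<delta> \<longrightarrow> dist (\<Phi> g) (\<Phi> h) < r"
      using contr le_less_trans by blast
  qed simp
  then have "continuous_map X euclidean \<Phi>" by (simp add: X)
  moreover have "inj_on \<Phi> M"
  proof (rule inj_onI)
    fix g h assume gh: "g \<in> M" "h \<in> M" "\<Phi> g = \<Phi> h"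
    obtain t where "h = \<gamma> t" using gh(2) unfolding M[symmetric] \<gamma>(2)[symmetric] by blast
    then have "d g h = d h h" using app[OF gh(1), of t] app[OF gh(2), of t] gh(3) by simp
    then show "g = h" using gh by simp
  qed
  ultimately show thesis using that M by blast
qed

lemma jordan_curve_pull_back:
  fixes X :: "'a topology" and \<Phi> :: "'a \<Rightarrow> 'b::t2_space"
  assumes "compact_space X" "continuous_map X euclidean \<Phi>" "inj_on \<Phi> (topspace X)"
    and \<Gamma>: "compact \<Gamma>" "\<Gamma> \<subseteq> \<Phi> ` topspace X" "\<Gamma> homeomorphic unit_circle"
  shows "\<exists>C \<subseteq> topspace X. subtopology X C homeomorphic_space top_of_set unit_circle"
proof -
  define C where "C = {x \<in> topspace X. \<Phi> x \<in> \<Gamma>}"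
  have "closedin X C"
    unfolding C_def using assms(2) \<Gamma>(1)
    by (intro closedin_continuous_map_preimage[of X euclidean]) (auto intro: compact_imp_closed)
  then have "compactin X C" using assms(1) closedin_compact_space by blast
  then have comp: "compact_space (subtopology X C)" by (simp add: compact_space_subtopology)
  have top: "topspace X \<inter> C = C" by (auto simp: C_def)
  have cont: "continuous_map (subtopology X C) (top_of_set \<Gamma>) \<Phi>"
    using assms(2) by (auto simp: continuous_map_in_subtopology continuous_map_from_subtopology C_def)
  have "closed_map (subtopology X C) (top_of_set \<Gamma>) \<Phi>"
  proof (rule continuous_imp_closed_map_gen[OF comp _ cont])
    show "kc_space (top_of_set \<Gamma>)"
      by (intro Hausdorff_imp_kc_space Hausdorff_space_subtopology)
        (use hausdorff in \<open>auto simp: Hausdorff_space_def disjnt_def\<close>)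
  qed
  moreover have "inj_on \<Phi> C" using assms(3) by (rule inj_on_subset) (auto simp: C_def)
  moreover have "\<Phi> ` C = \<Gamma>" using \<Gamma>(2) by (auto simp: C_def)
  ultimately have "homeomorphic_map (subtopology X C) (top_of_set \<Gamma>) \<Phi>"
    using cont by (intro bijective_closed_imp_homeomorphic_map) (auto simp: top)
  then have "subtopology X C homeomorphic_space top_of_set \<Gamma>"
    by (rule homeomorphic_map_imp_homeomorphic_space)
  moreover have "top_of_set \<Gamma> homeomorphic_space top_of_set unit_circle"
  proof -
    obtain f g where "homeomorphism \<Gamma> unit_circle f g" using \<Gamma>(3) unfolding homeomorphic_def by blast
    then have "homeomorphic_maps (top_of_set \<Gamma>) (top_of_set unit_circle) f g"
      unfolding homeomorphism_def homeomorphic_maps_def by (auto simp: continuous_map_subtopology_eu)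
    then show ?thesis unfolding homeomorphic_space_def by blast
  qed
  ultimately have "subtopology X C homeomorphic_space top_of_set unit_circle"
    by (rule homeomorphic_space_trans)
  moreover have "C \<subseteq> topspace X" by (auto simp: C_def)
  ultimately show ?thesis by blast
qed

lemma continuous_map_class:
  "equiv unit_circle R \<Longrightarrow> continuous_map (top_of_set unit_circle) (julia R) (\<lambda>z. R `` {z})"
  unfolding continuous_map_def julia_def openin_quotient_topology topspace_quotient_topology
  by (auto intro: quotientI)

lemma topspace_julia [simp]: "topspace (julia R) = unit_circle // R"
  by (simp add: julia_def)

lemma continuous_map_class_ang:
  assumes "equiv unit_circle R"
  shows "continuous_map euclidean (julia R) (\<lambda>x. R `` {ang x})"
proof -
  have "continuous_map euclidean (top_of_set unit_circle) ang"
    using continuous_on_ang[of UNIV "\<lambda>x. x"] by (simp add: continuous_map_in_subtopology)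
  then show ?thesis
    using continuous_map_compose[OF _ continuous_map_class[OF assms]] by (force simp: o_def)
qed

lemma range_class_ang:
  "range (\<lambda>x. R `` {ang x}) = topspace (julia R)"
proof (intro equalityI subsetI)
  fix g assume "g \<in> topspace (julia R)"
  then obtain z where "z \<in> unit_circle" "g = R `` {z}" by (auto elim: quotientE)
  moreover from this obtain x where "z = ang x" using ang_cases[of z 0] by blast
  ultimately show "g \<in> range (\<lambda>x. R `` {ang x})" by blast
qed (auto intro: quotientI)

text \<open>The two arcs of the circle between \<open>a\<close> and \<open>b\<close> are mapped to two paths in the quotient with
  common end points. If no class other than those of \<open>a\<close> and \<open>b\<close> meets both open arcs, the paths have nothing else in
  common, and arcs contained in them form a Jordan curve.\<close>

lemma dendrite_separates:
  assumes eq: "equiv unit_circle R" and den: "dendrite (julia R)"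
    and ab: "a < b" "b < a + 1" "(ang a, ang b) \<notin> R"
  obtains s t where "a < s" "s < b" "b < t" "t < a + 1" "(ang s, ang t) \<in> R"
    "(ang a, ang s) \<notin> R" "(ang b, ang s) \<notin> R"
proof (rule ccontr)
  note witness = that
  assume "\<not> thesis"
  then have none: "(ang a, ang s) \<in> R \<or> (ang b, ang s) \<in> R"
    if "a < s" "s < b" "b < t" "t < a + 1" "(ang s, ang t) \<in> R" for s t
    using that witness by blast
  define q where "q x = R `` {ang x}" for x
  have q_eq: "q x = q y \<longleftrightarrow> (ang x, ang y) \<in> R" for x y
    unfolding q_def using eq_equiv_class_iff[OF eq] by simp
  have X: "metrizable_space (julia R)" "compact_space (julia R)"
    using den by (auto simp: dendrite_def)
  have qc: "continuous_map euclidean (julia R) q" and qr: "range q = topspace (julia R)"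
    unfolding q_def using continuous_map_class_ang[OF eq] range_class_ang by auto
  obtain \<Phi> :: "complex set \<Rightarrow> (real \<Rightarrow>\<^sub>C real)" where
    \<Phi>: "continuous_map (julia R) euclidean \<Phi>" "inj_on \<Phi> (topspace (julia R))"
    using embedding_in_bounded_functions[OF X qc qr] by blast
  define f where "f x = \<Phi> (q x)" for x
  have "continuous_map euclidean euclidean f"
    using continuous_map_compose[OF qc \<Phi>(1)] by (simp add: o_def f_def)
  then have fc: "continuous_on UNIV f" by simp
  have f_eq: "f x = f y \<longleftrightarrow> (ang x, ang y) \<in> R" for x y
    unfolding f_def q_eq[symmetric] using \<Phi>(2) qr by (metis inj_on_eq_iff rangeI)
  have arcs: "\<exists>p. arc p \<and> path_image p \<subseteq> f ` {l..h} \<and> pathstart p = f l \<and> pathfinish p = f h"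
    if lh: "l < h" "f l \<noteq> f h" for l h
  proof -
    have "path (\<lambda>x. f (l + (h - l) * x))" unfolding path_def
      by (intro continuous_on_compose2[OF fc] continuous_intros) auto
    moreover have "pathstart (\<lambda>x. f (l + (h - l) * x)) = f l"
      "pathfinish (\<lambda>x. f (l + (h - l) * x)) = f h"
      by (simp_all add: pathstart_def pathfinish_def)
    ultimately obtain p where p: "arc p" "path_image p \<subseteq> path_image (\<lambda>x. f (l + (h - l) * x))"
      "pathstart p = f l" "pathfinish p = f h"
      using path_contains_arc[OF _ _ _ lh(2)] by metis
    moreover have "path_image (\<lambda>x. f (l + (h - l) * x)) \<subseteq> f ` {l..h}"
    proof
      fix y assume "y \<in> path_image (\<lambda>x. f (l + (h - l) * x))"
      then obtain x where x: "0 \<le> x" "x \<le> 1" "y = f (l + (h - l) * x)"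
        by (auto simp: path_image_def)
      have "(h - l) * x \<le> (h - l) * 1" using lh x by (intro mult_left_mono) auto
      moreover have "0 \<le> (h - l) * x" using lh x by simp
      ultimately show "y \<in> f ` {l..h}" using x by auto
    qed
    ultimately show ?thesis by blast
  qed
  have "f a \<noteq> f b" using ab f_eq by blast
  moreover have fa: "f (a + 1) = f a" by (simp add: f_def q_def)
  ultimately obtain p1 p2 where
    p1: "arc p1" "path_image p1 \<subseteq> f ` {a..b}" "pathstart p1 = f a" "pathfinish p1 = f b" and
    p2: "arc p2" "path_image p2 \<subseteq> f ` {b..a+1}" "pathstart p2 = f b" "pathfinish p2 = f a"
    using arcs[of a b] arcs[of b "a + 1"] ab by auto
  have "f ` {a..b} \<inter> f ` {b..a+1} \<subseteq> {f a, f b}"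
  proof
    fix y assume "y \<in> f ` {a..b} \<inter> f ` {b..a+1}"
    then obtain s t where st: "a \<le> s" "s \<le> b" "b \<le> t" "t \<le> a + 1" "y = f s" "f s = f t" by auto
    show "y \<in> {f a, f b}"
    proof (cases "s = a \<or> s = b \<or> t = b \<or> t = a + 1")
      case True
      then show ?thesis using st fa by auto
    next
      case False
      then have "a < s" "s < b" "b < t" "t < a + 1" using st by auto
      then have "f a = f s \<or> f b = f s" using none[of s t] st f_eq by blast
      then show ?thesis using st by auto
    qed
  qed
  then have inter: "path_image p1 \<inter> path_image p2 \<subseteq> {pathstart p1, pathstart p2}"
    using p1 p2 by auto
  have "simple_path (p1 +++ p2)"
    using simple_path_join_loop[OF p1(1) p2(1) _ _ inter] p1 p2 by simp
  moreover have "pathfinish (p1 +++ p2) = pathstart (p1 +++ p2)" using p1 p2 by simp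
  ultimately have hom: "path_image (p1 +++ p2) homeomorphic unit_circle"
    by (rule homeomorphic_simple_path_image_circle) simp
  have "compact (path_image (p1 +++ p2))"
    using \<open>simple_path (p1 +++ p2)\<close> by (simp add: compact_path_image simple_path_imp_path)
  moreover have "path_image (p1 +++ p2) \<subseteq> \<Phi> ` topspace (julia R)"
  proof -
    have "path_image (p1 +++ p2) \<subseteq> range f"
      using path_image_join_subset[of p1 p2] p1(2) p2(2) by blast
    also have "range f = \<Phi> ` topspace (julia R)" unfolding f_def qr[symmetric] by auto
    finally show ?thesis .
  qed
  ultimately have "\<exists>C \<subseteq> topspace (julia R). subtopology (julia R) C homeomorphic_space top_of_set unit_circle"
    using jordan_curve_pull_back[OF X(2) \<Phi> _ _ hom] by blast
  then show False using den unfolding dendrite_def by blast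
qed

section \<open>Poincare recurrence and invariant measures\<close>

lemma measurable_funpow [measurable]: "f \<in> measurable M M \<Longrightarrow> f ^^ n \<in> measurable M M"
  by (induction n) (auto intro: measurable_comp)

lemma measure_funpow_vimage:
  assumes "f \<in> measurable M M" "\<forall>A \<in> sets M. measure M (f -` A \<inter> space M) = measure M A"
    and "A \<in> sets M"
  shows "measure M ((f ^^ n) -` A \<inter> space M) = measure M A"
  using assms(3)
proof (induction n arbitrary: A)
  case 0
  then show ?case using sets.sets_into_space[OF 0] by (simp add: Int_absorb2)
next
  case (Suc n)
  have eq: "(f ^^ n) -` (f -` A \<inter> space M) \<inter> space M = (f ^^ Suc n) -` A \<inter> space M"
    using measurable_space[OF measurable_funpow[OF assms(1)]] by auto
  show ?case
    unfolding eq[symmetric] Suc.IH[OF measurable_sets[OF assms(1) Suc.prems]]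
    using assms(2) Suc.prems by blast
qed

text \<open>The preimages under the iterates of the set of points that never return are pairwise disjoint and have equal measure.\<close>

lemma poincare_recurrence:
  assumes "finite_measure M" and f: "f \<in> measurable M M"
    and inv: "\<forall>A \<in> sets M. measure M (f -` A \<inter> space M) = measure M A" and A: "A \<in> sets M"
  shows "{x \<in> A. \<forall>n\<ge>1. (f ^^ n) x \<notin> A} \<in> null_sets M"
proof -
  interpret finite_measure M by fact
  define B where "B = {x \<in> A. \<forall>n\<ge>1. (f ^^ n) x \<notin> A}"
  have B: "B \<in> sets M"
  proof -
    have "B = A - (\<Union>n\<in>{1..}. (f ^^ n) -` A \<inter> space M)"
      using sets.sets_into_space[OF A] by (auto simp: B_def)
    moreover have "(\<Union>n\<in>{1..}. (f ^^ n) -` A \<inter> space M) \<in> sets M"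
      using measurable_sets[OF measurable_funpow[OF f] A] by (intro sets.countable_UN) auto
    ultimately show ?thesis using A by simp
  qed
  define P where "P n = (f ^^ n) -` B \<inter> space M" for n
  have P: "P n \<in> sets M" for n
    unfolding P_def using measurable_sets[OF measurable_funpow[OF f] B] .
  have "disjoint_family P"
  proof -
    have "P m \<inter> P n = {}" if "m < n" for m n
    proof (rule ccontr)
      assume "P m \<inter> P n \<noteq> {}"
      then obtain x where x: "(f ^^ m) x \<in> B" "(f ^^ n) x \<in> B" by (auto simp: P_def)
      have "(f ^^ n) x = (f ^^ (n - m)) ((f ^^ m) x)"
        using that funpow_add[of "n - m" m f] by simp
      moreover have "1 \<le> n - m" using that by simp
      moreover have "\<forall>k\<ge>1. (f ^^ k) ((f ^^ m) x) \<notin> A" using x(1) by (simp add: B_def)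
      ultimately have "(f ^^ n) x \<notin> A" by metis
      then show False using x(2) by (simp add: B_def)
    qed
    then show ?thesis unfolding disjoint_family_on_def
      by (metis Int_commute nat_neq_iff)
  qed
  then have "(\<lambda>n. measure M (P n)) sums measure M (\<Union>n. P n)"
    using P by (intro finite_measure_UNION) auto
  then have "summable (\<lambda>n. measure M B)"
    using measure_funpow_vimage[OF f inv B] by (simp add: P_def sums_iff)
  then have "measure M B = 0" by (simp add: summable_const_iff)
  then have "B \<in> null_sets M" using B by (simp add: null_sets_def emeasure_eq_measure)
  then show ?thesis unfolding B_def .
qed

lemma invariant_prob_restrict:
  assumes "invariant_prob X f M" "A \<in> sets M" "measure M A \<noteq> 0"
    and AE: "AE x in M. f x \<in> A \<longleftrightarrow> x \<in> A"
  shows "invariant_prob X f (uniform_measure M A)"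
proof -
  interpret prob_space M using assms(1) by (simp add: invariant_prob_def)
  have f: "f \<in> measurable M M" and sets: "sets M = sets (borel_of X)"
    and inv: "\<And>B. B \<in> sets M \<Longrightarrow> measure M (f -` B \<inter> space M) = measure M B"
    using assms(1) by (auto simp: invariant_prob_def)
  have A: "emeasure M A \<noteq> 0" "emeasure M A \<noteq> \<infinity>"
    using assms(3) by (auto simp: emeasure_eq_measure)
  have "measure (uniform_measure M A) (f -` B \<inter> space M) = measure (uniform_measure M A) B"
    if B: "B \<in> sets M" for B
  proof -
    have fB: "f -` B \<inter> space M \<in> sets M" using f B by (rule measurable_sets)
    have fAB: "f -` (A \<inter> B) \<inter> space M \<in> sets M"
      using f sets.Int[OF assms(2) B] by (rule measurable_sets)
    have "measure M (A \<inter> (f -` B \<inter> space M)) = measure M (f -` (A \<inter> B) \<inter> space M)"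
      using AE assms(2) fB fAB by (intro finite_measure_eq_AE) auto
    also have "\<dots> = measure M (A \<inter> B)" using inv sets.Int[OF assms(2) B] by blast
    finally show ?thesis using A B fB by simp
  qed
  moreover have "prob_space (uniform_measure M A)" using A by (intro prob_space_uniform_measure)
  moreover have "f \<in> measurable (uniform_measure M A) (uniform_measure M A)"
    using f by (simp cong: measurable_cong_sets)
  ultimately show ?thesis unfolding invariant_prob_def by (simp add: sets)
qed

text \<open>The uniform distribution on the orbit, taken over one period of times so that the points need
  not be distinct.\<close>

lemma periodic_orbit_measure:
  assumes "sets M = sets (borel_of X)" and f: "f \<in> measurable M M"
    and x: "x \<in> space M" and n: "1 \<le> n" "(f ^^ n) x = x"
    and S: "S \<in> sets M" "\<And>k. (f ^^ k) x \<in> S"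
  obtains \<nu> where "invariant_prob X f \<nu>" "supported_on \<nu> S"
proof -
  define \<nu> where "\<nu> = distr (measure_pmf (pmf_of_set {..<n})) M (\<lambda>k. (f ^^ k) x)"
  have orbit: "(f ^^ k) x \<in> space M" for k
    using measurable_space[OF measurable_funpow[OF f] x] .
  have fin: "finite {..<n}" "{..<n} \<noteq> {}" using n(1) by (auto simp: lessThan_empty_iff)
  have meas: "(\<lambda>k. (f ^^ k) x) \<in> measurable (measure_pmf (pmf_of_set {..<n})) M"
    using orbit by (auto simp: measurable_def)
  have \<nu>: "measure \<nu> A = (\<Sum>k<n. indicator A ((f ^^ k) x)) / n" if "A \<in> sets M" for A
  proof -
    have "measure \<nu> A = measure_pmf.prob (pmf_of_set {..<n}) {k. (f ^^ k) x \<in> A}"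
      unfolding \<nu>_def using measure_distr[OF meas that] by (simp add: vimage_def)
    also have "\<dots> = card ({..<n} \<inter> {k. (f ^^ k) x \<in> A}) / n"
      using measure_pmf_of_set[OF fin(2,1)] by simp
    also have "real (card ({..<n} \<inter> {k. (f ^^ k) x \<in> A})) = (\<Sum>k<n. indicator A ((f ^^ k) x))"
      by (simp add: indicator_def sum.If_cases)
    finally show ?thesis .
  qed
  have sets\<nu>: "sets \<nu> = sets M" and space\<nu>: "space \<nu> = space M" by (simp_all add: \<nu>_def)
  have "measure \<nu> (f -` A \<inter> space M) = measure \<nu> A" if A: "A \<in> sets M" for A
  proof -
    have "(\<Sum>k<n. indicator (f -` A \<inter> space M) ((f ^^ k) x)) = (\<Sum>k<n. indicator A ((f ^^ Suc k) x) :: real)"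
      using orbit by (intro sum.cong) (auto simp: indicator_def)
    also have "\<dots> = (\<Sum>k<n. indicator A ((f ^^ k) x)) + indicator A ((f ^^ n) x) - indicator A ((f ^^ 0) x)"
      using sum.lessThan_Suc_shift[of "\<lambda>k. indicator A ((f ^^ k) x) :: real" n]
        sum.lessThan_Suc[of "\<lambda>k. indicator A ((f ^^ k) x) :: real" n] by simp
    also have "\<dots> = (\<Sum>k<n. indicator A ((f ^^ k) x))" using n(2) by simp
    finally show ?thesis using \<nu> A measurable_sets[OF f A] by simp
  qed
  moreover have "prob_space \<nu>" unfolding \<nu>_def using meas by (rule measure_pmf.prob_space_distr)
  moreover have "f \<in> measurable \<nu> \<nu>" using f sets\<nu> by (simp cong: measurable_cong_sets)
  ultimately have "invariant_prob X f \<nu>"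
    unfolding invariant_prob_def using assms(1) by (simp add: sets\<nu> space\<nu>)
  moreover have "supported_on \<nu> S"
    unfolding supported_on_def using \<nu>[OF S(1)] S(2) n(1) by simp
  ultimately show thesis using that by blast
qed

lemma space_borel_of: "space (borel_of X) = topspace X"
  unfolding borel_of_def by (intro space_measure_of) (auto dest: openin_subset)

lemma closedin_in_borel_of:
  assumes "closedin X A" shows "A \<in> sets (borel_of X)"
proof -
  have "sets (borel_of X) = sigma_sets (topspace X) {U. openin X U}"
    unfolding borel_of_def by (intro sets_measure_of) (auto dest: openin_subset)
  then have "topspace X - A \<in> sets (borel_of X)"
    using assms by (auto simp: closedin_def)
  then have "space (borel_of X) - (topspace X - A) \<in> sets (borel_of X)" by (rule sets.compl_sets)
  moreover have "topspace X - (topspace X - A) = A" using closedin_subset[OF assms] by blast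
  ultimately show ?thesis by (simp add: space_borel_of)
qed

section \<open>Endpoints and cutpoints as classes of angles\<close>

locale dendritic_lamination =
  fixes d :: nat and R :: "(complex \<times> complex) set"
  assumes d2: "d \<ge> 2" and inv: "invariant_lamination d R" and den: "dendrite (julia R)"
begin

abbreviation E :: "real \<Rightarrow> real \<Rightarrow> bool" where
  "E x y \<equiv> (ang x, ang y) \<in> R"

definition cls :: "real \<Rightarrow> complex set" where
  "cls x = R `` {ang x}"

lemma lam: "lamination R"
  and image_class: "g \<in> unit_circle // R \<Longrightarrow> sigma_map d ` g \<in> unit_circle // R"
  and finite_classes: "g \<in> unit_circle // R \<Longrightarrow> finite g"
  using inv unfolding invariant_lamination_def by auto

lemma equiv: "equiv unit_circle R"
  using lam by (simp add: lamination_def)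

lemma closed_R: "closed R"
proof -
  have "closedin (top_of_set (unit_circle \<times> unit_circle)) R" using lam by (simp add: lamination_def)
  then show ?thesis by (rule closedin_closed_trans) (intro closed_Times closed_sphere)
qed

lemma R_subset: "R \<subseteq> unit_circle \<times> unit_circle"
  using equiv by (rule equiv_type)

lemma cls_eq_iff: "cls x = cls y \<longleftrightarrow> E x y"
  unfolding cls_def using eq_equiv_class_iff[OF equiv] by simp

lemma cls_in: "cls x \<in> unit_circle // R"
  unfolding cls_def by (intro quotientI) simp

lemma range_cls: "range cls = unit_circle // R"
  using range_class_ang[of R] by (simp add: cls_def)

lemma cls_cases:
  assumes "g \<in> unit_circle // R" obtains x where "g = cls x"
  using assms range_cls by (metis rangeE)

lemma cls_shift [simp]: "cls (x + of_int k) = cls x" "cls (x - of_int k) = cls x" "cls (x + 1) = cls x"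
  by (simp_all add: cls_def)

lemma mem_cls: "ang y \<in> cls x \<longleftrightarrow> E x y"
  by (simp add: cls_def)

lemma E_refl: "E x x" and E_sym: "E x y \<Longrightarrow> E y x" and E_trans: "E x y \<Longrightarrow> E y z \<Longrightarrow> E x z"
  by (metis cls_eq_iff)+

lemma E_unlinked:
  assumes "a < c" "c < b" "b < e" "e < a + 1" "E a b" "E c e"
  shows "E a c"
proof -
  have "E b c"
  proof (rule ccontr)
    assume "\<not> E b c"
    then have "open_segment (ang a) (ang b) \<inter> open_segment (ang c) (ang e) = {}"
      using lam assms(5,6) unfolding lamination_def by blast
    then show False using crossing_chords_meet[OF assms(1-4)] by blast
  qed
  then show ?thesis using assms(5) E_trans by blast
qed

lemma E_finite: "finite {y \<in> {x..<x+1}. E x y}"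
proof (rule finite_imageD)
  have "ang ` {y \<in> {x..<x+1}. E x y} \<subseteq> cls x" by (auto simp: mem_cls)
  then show "finite (ang ` {y \<in> {x..<x+1}. E x y})"
    using finite_classes[OF cls_in] finite_subset by blast
  show "inj_on ang {y \<in> {x..<x+1}. E x y}"
  proof (rule inj_onI)
    fix y z assume yz: "y \<in> {y \<in> {x..<x+1}. E x y}" "z \<in> {y \<in> {x..<x+1}. E x y}" "ang y = ang z"
    then obtain k :: int where k: "y - z = k" by (auto simp: ang_eq_iff elim: Ints_cases)
    then have "-1 < real_of_int k" "real_of_int k < 1" using yz by auto
    then have "k = 0" by simp
    then show "y = z" using k by simp
  qed
qed

sublocale angle_lamination E
proof
  have "{p. E (fst p) (snd p)} = (\<lambda>p. (ang (fst p), ang (snd p))) -` R" by auto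
  also have "closed \<dots>"
    by (intro closed_vimage closed_R continuous_intros)
  finally show "closed {p. E (fst p) (snd p)}" .
next
  fix a b assume "a < b" "b < a + 1" "\<not> E a b"
  then show "\<exists>s t. a < s \<and> s < b \<and> b < t \<and> t < a + 1 \<and> E s t \<and> \<not> E a s \<and> \<not> E b s"
    using dendrite_separates[OF equiv den] by blast
next
  fix a b c e assume "a < c" "c < b" "b < e" "e < a + 1" "E a b" "E c e"
  then show "E a c" by (rule E_unlinked)
next
  fix x y z assume "E x y" "E y z"
  then show "E x z" by (rule E_trans)
next
  show "finite {y \<in> {x..<x+1}. E x y}" for x by (rule E_finite)
qed (simp_all add: E_refl E_sym)

lemma sigma_class: "sigma_map d ` cls x = cls (real d * x)"
proof -
  obtain y where y: "sigma_map d ` cls x = cls y" using image_class[OF cls_in] cls_cases by metis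
  have "ang x \<in> cls x" by (simp add: mem_cls E_refl)
  then have "sigma_map d (ang x) \<in> cls y" unfolding y[symmetric] by blast
  then have "E y (real d * x)" by (simp add: sigma_map_def ang_power mem_cls)
  then show ?thesis using y cls_eq_iff by simp
qed

lemma compatible_d: "compatible d"
  unfolding compatible_def
proof (intro conjI allI impI d2)
  fix x y assume "E x y"
  then have "cls x = cls y" by (simp add: cls_eq_iff)
  then have "cls (real d * x) = cls (real d * y)" by (metis sigma_class)
  then show "E (real d * x) (real d * y)" by (simp add: cls_eq_iff)
next
  fix x y assume "E (real d * x) y"
  then have "ang y \<in> sigma_map d ` cls x" by (simp add: sigma_class mem_cls)
  then obtain w where w: "w \<in> cls x" "ang y = sigma_map d w" by blast
  have "w \<in> unit_circle" using w(1) R_subset by (auto simp: cls_def)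
  then obtain z where z: "w = ang z" using ang_cases[of w 0] by blast
  have "E x z" using w(1) z by (simp add: mem_cls)
  moreover have "ang (real d * z) = ang y" using w(2) z by (simp add: sigma_map_def ang_power)
  then have "real d * z - y \<in> \<int>" by (simp add: ang_eq_iff)
  then obtain k :: int where "real d * z - y = k" by (auto elim: Ints_cases)
  then have "real d * z = y + of_int k" by simp
  ultimately show "\<exists>z. E x z \<and> (\<exists>k::int. real d * z = y + of_int k)" by blast
qed

lemma top_poly_cls: "top_poly d R (cls x) = cls (real d * x)"
  unfolding cls_def using top_poly_class[OF inv, of "ang x"] by (simp add: sigma_map_def ang_power)

lemma top_poly_funpow_cls: "(top_poly d R ^^ n) (cls x) = cls (real d ^ n * x)"
  by (induction n) (simp_all add: top_poly_cls mult.assoc)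

lemma continuous_map_cls: "continuous_map euclidean (julia R) cls"
  using continuous_map_class_ang[OF equiv] by (simp add: cls_def[abs_def])

text \<open>The saturation of a compact set under a closed relation on a compact space is closed.\<close>

lemma closedin_meets:
  assumes "compact K"
  shows "closedin (julia R) {g \<in> unit_circle // R. g \<inter> K \<noteq> {}}"
proof -
  have "compact (R \<inter> (unit_circle \<times> K))"
    using closed_R assms by (metis Int_commute compact_Int_closed compact_Times compact_sphere)
  then have "compact (fst ` (R \<inter> (unit_circle \<times> K)))"
    by (intro compact_continuous_image continuous_intros)
  moreover have "fst ` (R \<inter> (unit_circle \<times> K)) = {z \<in> unit_circle. R `` {z} \<inter> K \<noteq> {}}"
    using R_subset by force
  ultimately have "closed {z \<in> unit_circle. R `` {z} \<inter> K \<noteq> {}}" by (simp add: compact_imp_closed)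
  then have "openin (top_of_set unit_circle) (unit_circle - {z \<in> unit_circle. R `` {z} \<inter> K \<noteq> {}})"
    by (intro openin_diff closed_subset) auto
  moreover have "unit_circle - {z \<in> unit_circle. R `` {z} \<inter> K \<noteq> {}} =
    {z \<in> unit_circle. R `` {z} \<in> unit_circle // R - {g \<in> unit_circle // R. g \<inter> K \<noteq> {}}}"
    by (auto intro: quotientI)
  ultimately have "openin (julia R) (unit_circle // R - {g \<in> unit_circle // R. g \<inter> K \<noteq> {}})"
    unfolding julia_def openin_quotient_topology by auto
  then show ?thesis unfolding closedin_def by auto
qed

text \<open>The complement of this side consists of the classes that meet the closed complementary arc or
  the class of \<open>a\<close>, which together form a compact set.\<close>

lemma openin_side:
  assumes ab: "a < b" "b < a + 1" "E a b"
  shows "openin (julia R) (cls ` {x. a < x \<and> x < b \<and> \<not> E a x})"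
proof -
  define F where "F = {y \<in> {a..<a+1}. E a y}"
  define K where "K = {b..a+1} \<union> F"
  have "compact K" unfolding K_def F_def using E_finite finite_imp_compact by (intro compact_Un) auto
  then have "compact (ang ` K)" by (intro compact_continuous_image continuous_intros)
  then have "closedin (julia R) {g \<in> unit_circle // R. g \<inter> ang ` K \<noteq> {}}" by (rule closedin_meets)
  then have "openin (julia R) (unit_circle // R - {g \<in> unit_circle // R. g \<inter> ang ` K \<noteq> {}})"
    by (simp add: closedin_def)
  also have "unit_circle // R - {g \<in> unit_circle // R. g \<inter> ang ` K \<noteq> {}} =
    cls ` {x. a < x \<and> x < b \<and> \<not> E a x}"
  proof (intro equalityI subsetI)
    fix g assume g: "g \<in> unit_circle // R - {g \<in> unit_circle // R. g \<inter> ang ` K \<noteq> {}}"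
    then obtain y where y: "g = cls y" using cls_cases by blast
    define x where "x = y - of_int \<lfloor>y - a\<rfloor>"
    have x: "a \<le> x" "x < a + 1" "g = cls x" unfolding x_def y by (linarith, linarith, simp)
    then have "ang x \<in> g" by (simp add: mem_cls E_refl)
    then have "x \<notin> K" using g by blast
    then have "\<not> E a x" "x < b" using x by (auto simp: K_def F_def)
    moreover have "a < x" using x \<open>\<not> E a x\<close> E_refl by (cases "x = a") auto
    ultimately show "g \<in> cls ` {x. a < x \<and> x < b \<and> \<not> E a x}" using x by blast
  next
    fix g assume "g \<in> cls ` {x. a < x \<and> x < b \<and> \<not> E a x}"
    then obtain x where x: "g = cls x" "a < x" "x < b" "\<not> E a x" by blast
    have "\<not> E x y" if y: "y \<in> K" for y
    proof
      assume xy: "E x y"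
      have "y \<notin> F" using x(4) E_trans[OF _ E_sym[OF xy], of a] by (auto simp: F_def)
      then have "b \<le> y" "y \<le> a + 1" using y by (auto simp: K_def)
      moreover obtain j :: int where j: "a < y - j" "y - j < b"
        using class_in_arc[OF ab(3) x(2,3) ab(2) xy x(4)] by blast
      ultimately have "0 < real_of_int j" "real_of_int j < 1" by linarith+
      then show False by simp
    qed
    then have "g \<inter> ang ` K = {}" by (auto simp: x mem_cls)
    then show "g \<in> unit_circle // R - {g \<in> unit_circle // R. g \<inter> ang ` K \<noteq> {}}"
      using cls_in x(1) by blast
  qed
  finally show ?thesis .
qed

lemma side_nonempty:
  assumes "a < b" "b < a + 1"
  shows "\<exists>x. a < x \<and> x < b \<and> \<not> E a x"
proof (rule ccontr)
  assume "\<not> ?thesis"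
  then have "{a<..<b} \<subseteq> {y \<in> {a..<a+1}. E a y}" using assms by auto
  then have "finite {a<..<b}" using E_finite finite_subset by blast
  then show False using infinite_Ioo[OF assms(1)] by blast
qed

text \<open>The two sides of a chord are open and disjoint, and no class other than that of \<open>a\<close> avoids both.\<close>

lemma not_connected_without_cut:
  assumes ab: "a < b" "b < a + 1" "E a b"
  shows "\<not> connectedin (julia R) (unit_circle // R - {cls a})"
proof -
  define U V where "U = cls ` {x. a < x \<and> x < b \<and> \<not> E a x}" and
    "V = cls ` {x. b < x \<and> x < a + 1 \<and> \<not> E b x}"
  have ba: "b < a + 1" "a + 1 < b + 1" "E b (a + 1)" using ab E_sym by simp_all
  have "openin (julia R) U" "openin (julia R) V"
    unfolding U_def V_def using openin_side[OF ab] openin_side[OF ba] by auto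
  moreover have "unit_circle // R - {cls a} \<subseteq> U \<union> V"
  proof
    fix g assume g: "g \<in> unit_circle // R - {cls a}"
    then obtain y where y: "g = cls y" using cls_cases by blast
    define x where "x = y - of_int \<lfloor>y - a\<rfloor>"
    have x: "a \<le> x" "x < a + 1" "g = cls x" unfolding x_def y by (linarith, linarith, simp)
    have ne: "\<not> E a x" "\<not> E b x" using g x ab(3) cls_eq_iff by (metis DiffD2 singletonI)+
    then have "x \<noteq> a" "x \<noteq> b" using E_refl by auto
    then consider "a < x" "x < b" | "b < x" using x by linarith
    then show "g \<in> U \<union> V"
      using x(2,3) ne by cases (auto simp: U_def V_def)
  qed
  moreover have "U \<inter> V = {}"
  proof (rule ccontr)
    assume "U \<inter> V \<noteq> {}"
    then obtain x y where xy: "a < x" "x < b" "\<not> E a x" "b < y" "y < a + 1" "cls x = cls y"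
      by (auto simp: U_def V_def)
    then have "E x y" by (simp add: cls_eq_iff)
    then obtain j :: int where j: "a < y - j" "y - j < b"
      using class_in_arc[OF ab(3) xy(1,2) ab(2) _ xy(3)] by blast
    then have "0 < real_of_int j" "real_of_int j < 1" using xy by linarith+
    then show False by simp
  qed
  moreover have "U \<inter> (unit_circle // R - {cls a}) \<noteq> {}"
  proof -
    obtain x where x: "a < x" "x < b" "\<not> E a x" using side_nonempty[OF ab(1,2)] by blast
    then have "cls x \<noteq> cls a" using cls_eq_iff by metis
    then show ?thesis using x cls_in by (auto simp: U_def)
  qed
  moreover have "V \<inter> (unit_circle // R - {cls a}) \<noteq> {}"
  proof -
    obtain x where x: "b < x" "x < a + 1" "\<not> E b x" using side_nonempty[OF ba(1,2)] by blast
    then have "cls x \<noteq> cls a" using ab(3) cls_eq_iff by metis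
    then show ?thesis using x cls_in by (auto simp: V_def)
  qed
  ultimately show ?thesis unfolding connectedin by blast
qed

lemma connected_without_singleton:
  assumes "\<And>y. E a y \<Longrightarrow> y - a \<in> \<int>"
  shows "connectedin (julia R) (unit_circle // R - {cls a})"
proof -
  have "unit_circle // R - {cls a} = cls ` {a<..<a+1}"
  proof (intro equalityI subsetI)
    fix g assume g: "g \<in> unit_circle // R - {cls a}"
    then obtain y where y: "g = cls y" using cls_cases by blast
    define x where "x = y - of_int \<lfloor>y - a\<rfloor>"
    have x: "a \<le> x" "x < a + 1" "g = cls x" unfolding x_def y by (linarith, linarith, simp)
    moreover have "x \<noteq> a" using g x by auto
    ultimately show "g \<in> cls ` {a<..<a+1}" by auto
  next
    fix g assume "g \<in> cls ` {a<..<a+1}"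
    then obtain x where x: "g = cls x" "a < x" "x < a + 1" by auto
    have "cls x \<noteq> cls a"
    proof
      assume "cls x = cls a"
      then have "x - a \<in> \<int>" using assms cls_eq_iff by metis
      then obtain k :: int where "x - a = k" by (auto elim: Ints_cases)
      then have "0 < real_of_int k" "real_of_int k < 1" using x by linarith+
      then show False by simp
    qed
    then show "g \<in> unit_circle // R - {cls a}" using x cls_in by auto
  qed
  then show ?thesis
    using connectedin_continuous_map_image[OF continuous_map_cls, of "{a<..<a+1}"] by simp
qed

lemma cutpoint_iff: "cls a \<in> cutpoints (julia R) \<longleftrightarrow> (\<exists>b. a < b \<and> b < a + 1 \<and> E a b)"
proof
  assume cut: "cls a \<in> cutpoints (julia R)"
  then have "\<not> connectedin (julia R) (unit_circle // R - {cls a})" by (simp add: cutpoints_def)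
  then obtain y where y: "E a y" "y - a \<notin> \<int>" using connected_without_singleton by blast
  define b where "b = y - of_int \<lfloor>y - a\<rfloor>"
  have b: "a \<le> b" "b < a + 1" "E a b" unfolding b_def using y by (linarith, linarith, simp)
  moreover have "b \<noteq> a"
  proof
    assume "b = a"
    then have "y - a = of_int \<lfloor>y - a\<rfloor>" by (simp add: b_def)
    then show False using y Ints_of_int by metis
  qed
  ultimately show "\<exists>b. a < b \<and> b < a + 1 \<and> E a b" by (metis order_le_less)
next
  assume "\<exists>b. a < b \<and> b < a + 1 \<and> E a b"
  then show "cls a \<in> cutpoints (julia R)"
    using not_connected_without_cut cls_in by (auto simp: cutpoints_def)
qed

lemma endpoint_iff: "cls a \<in> endpoints (julia R) \<longleftrightarrow> cls a \<notin> cutpoints (julia R)"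
  using cls_in by (auto simp: endpoints_def cutpoints_def)

text \<open>The image of a class is a full class, so it has no more angles than the class itself.\<close>

lemma top_poly_endpoint:
  assumes "g \<in> endpoints (julia R)"
  shows "top_poly d R g \<in> endpoints (julia R)"
proof -
  have "g \<in> unit_circle // R" using assms by (simp add: endpoints_def)
  then obtain a where a: "g = cls a" using cls_cases by blast
  show ?thesis
  proof (rule ccontr)
    assume "\<not> ?thesis"
    then have "cls (real d * a) \<in> cutpoints (julia R)" by (simp add: a top_poly_cls endpoint_iff)
    then obtain b where b: "real d * a < b" "b < real d * a + 1" "E (real d * a) b" unfolding cutpoint_iff by blast
    obtain z k where z: "E a z" "real d * z = b + of_int k"
      using compatibleD(3)[OF compatible_d b(3)] by blast
    define y where "y = z - of_int \<lfloor>z - a\<rfloor>"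
    have y: "a \<le> y" "y < a + 1" "E a y" unfolding y_def using z by (linarith, linarith, simp)
    have "y \<noteq> a"
    proof
      assume "y = a"
      then have "z = a + of_int \<lfloor>z - a\<rfloor>" by (simp add: y_def)
      then have "real d * z = real d * a + of_int (int d * \<lfloor>z - a\<rfloor>)"
        by (metis distrib_left of_int_mult of_int_of_nat_eq)
      then have *: "b - real d * a = of_int (int d * \<lfloor>z - a\<rfloor> - k)" using z(2) by simp
      have "0 < real_of_int (int d * \<lfloor>z - a\<rfloor> - k)" "real_of_int (int d * \<lfloor>z - a\<rfloor> - k) < 1"
        unfolding *[symmetric] using b by linarith+
      then show False unfolding of_int_0_less_iff of_int_less_1_iff by linarith
    qed
    then have "cls a \<in> cutpoints (julia R)" unfolding cutpoint_iff using y by (metis order_le_less)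
    then show False using assms by (simp add: a endpoint_iff)
  qed
qed

lemma periodic_cutpointI:
  assumes "1 \<le> k" "u < v" "v < u + 1" "E u v" "E u (real d ^ k * u)"
  shows "cls u \<in> periodic_cutpoints (julia R) (top_poly d R)"
proof -
  have "(top_poly d R ^^ k) (cls u) = cls u"
    unfolding top_poly_funpow_cls cls_eq_iff using assms(5) by (rule E_sym)
  then show ?thesis unfolding periodic_cutpoints_def using assms cutpoint_iff by blast
qed

lemma limit_in_closure:
  assumes "limit_of_periodic_cuts d a"
  shows "cls a \<in> julia R closure_of periodic_cutpoints (julia R) (top_poly d R)"
  unfolding in_closure_of
proof (intro conjI allI impI)
  show "cls a \<in> topspace (julia R)" using cls_in by simp
  fix T assume T: "cls a \<in> T \<and> openin (julia R) T"
  define W where "W = {x. cls x \<in> T}"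
  have "openin euclidean W"
    using openin_continuous_map_preimage[OF continuous_map_cls, of T] T by (simp add: W_def)
  then have "open W" by simp
  moreover have "compact {y \<in> {a..<a+1}. E a y}" using E_finite by (rule finite_imp_compact)
  moreover have "{y \<in> {a..<a+1}. E a y} \<subseteq> W"
  proof
    fix y assume "y \<in> {y \<in> {a..<a+1}. E a y}"
    then have "cls y = cls a" using cls_eq_iff E_sym by simp
    then show "y \<in> W" using T by (simp add: W_def)
  qed
  ultimately obtain r where r: "r > 0" "(\<Union>y\<in>{y \<in> {a..<a+1}. E a y}. cball y r) \<subseteq> W"
    using compact_subset_open_imp_cball_epsilon_subset[of "{y \<in> {a..<a+1}. E a y}" W] by blast
  obtain k u v c where k: "1 \<le> k" "u < v" "v < u + 1" "E u v" "E u (real d ^ k * u)"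
    and c: "E a c" "\<bar>u - c\<bar> < r"
    using assms r(1) unfolding limit_of_periodic_cuts_def by blast
  define j where "j = \<lfloor>c - a\<rfloor>"
  have "a \<le> c - j" "c - j < a + 1" unfolding j_def by linarith+
  then have "c - j \<in> {y \<in> {a..<a+1}. E a y}" using c(1) by simp
  moreover have "u - j \<in> cball (c - j) r" using c(2) by (simp add: dist_real_def abs_minus_commute)
  ultimately have "u - j \<in> W" using r(2) by blast
  then have "cls u \<in> T" by (simp add: W_def)
  then show "\<exists>y. y \<in> periodic_cutpoints (julia R) (top_poly d R) \<and> y \<in> T"
    using periodic_cutpointI[OF k] by blast
qed

lemma exists_periodic_cutpoint:
  obtains g where "g \<in> periodic_cutpoints (julia R) (top_poly d R)"
proof -
  obtain u v where "u < v" "v < u + 1" "E u v" "E u (real d * u)"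
    using exists_fixed_cut[OF compatible_d] by blast
  then show thesis using that[OF periodic_cutpointI[of 1 u v]] by simp
qed

lemma exists_periodic_endpoint:
  obtains g n where "g \<in> endpoints (julia R)" "1 \<le> n" "(top_poly d R ^^ n) g = g"
proof -
  obtain \<theta> n where \<theta>: "1 \<le> n" "real d ^ n * \<theta> - \<theta> \<in> \<int>" "\<And>y. E \<theta> y \<Longrightarrow> y - \<theta> \<in> \<int>"
    using exists_periodic_singleton[OF compatible_d] by blast
  have "cls \<theta> \<in> endpoints (julia R)"
    using connected_without_singleton[OF \<theta>(3)] cls_in by (simp add: endpoints_def)
  moreover have "ang (real d ^ n * \<theta>) = ang \<theta>" using \<theta>(2) by (simp add: ang_eq_iff)
  then have "(top_poly d R ^^ n) (cls \<theta>) = cls \<theta>"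
    unfolding top_poly_funpow_cls by (simp add: cls_def)
  ultimately show thesis using that \<theta>(1) by blast
qed

lemma topspace_split: "unit_circle // R = endpoints (julia R) \<union> cutpoints (julia R)"
  and endpoints_cutpoints_disjoint: "endpoints (julia R) \<inter> cutpoints (julia R) = {}"
  by (auto simp: endpoints_def cutpoints_def)

text \<open>Classes that join the arc from \<open>i\<close> to \<open>i'\<close> with the arc from \<open>j\<close> to \<open>j'\<close>. These closed sets
  control a chord with both of its end points, which neighbourhoods in the quotient do not: a
  class close to \<open>g\<close> in the quotient may have all its angles close to a single angle of \<open>g\<close>.\<close>

definition cell :: "real \<Rightarrow> real \<Rightarrow> real \<Rightarrow> real \<Rightarrow> complex set set" where
  "cell i i' j j' = {g \<in> unit_circle // R. g \<inter> ang ` {i..i'} \<noteq> {}} \<inter>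
     {g \<in> unit_circle // R. g \<inter> ang ` {j..j'} \<noteq> {}}"

lemma closedin_cell: "closedin (julia R) (cell i i' j j')"
  unfolding cell_def
  by (intro closedin_Int closedin_meets compact_continuous_image continuous_intros) auto

lemma cls_in_cell_iff:
  "cls x \<in> cell i i' j j' \<longleftrightarrow> (\<exists>s t. i \<le> s \<and> s \<le> i' \<and> j \<le> t \<and> t \<le> j' \<and> E x s \<and> E x t)"
proof -
  have "cls x \<inter> ang ` {l..h} \<noteq> {} \<longleftrightarrow> (\<exists>s. l \<le> s \<and> s \<le> h \<and> E x s)" for l h
    using mem_cls by fastforce
  then show ?thesis using cls_in[of x] by (auto simp: cell_def)
qed

text \<open>The two arcs are disjoint in the circle, so a class joining them has two angles. There are
  countably many indices.\<close>

definition cell_index :: "(real \<times> real \<times> real \<times> real) set" where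
  "cell_index = {(i, i', j, j') \<in> \<rat> \<times> \<rat> \<times> \<rat> \<times> \<rat>. i' < j \<and> j' < i + 1}"

lemma countable_cell_index: "countable cell_index"
proof (rule countable_subset)
  show "cell_index \<subseteq> \<rat> \<times> \<rat> \<times> \<rat> \<times> \<rat>" by (auto simp: cell_index_def)
qed (intro countable_SIGMA countable_rat)

lemma cell_around:
  assumes "a < b" "b < a + 1" "\<delta> > 0"
  obtains i i' j j' where "(i, i', j, j') \<in> cell_index" "a - \<delta> < i" "i < a" "a < i'" "i' < a + \<delta>"
    "b - \<delta> < j" "j < b" "b < j'" "j' < b + \<delta>"
proof -
  define r where "r = min \<delta> (min ((b - a) / 2) ((a + 1 - b) / 2))"
  have r: "r > 0" "r \<le> \<delta>" "r \<le> (b - a) / 2" "r \<le> (a + 1 - b) / 2"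
    using assms by (auto simp: r_def min_def field_simps)
  obtain i where i: "i \<in> \<rat>" "a - r < i" "i < a" using Rats_dense_in_real[of "a - r" a] r by auto
  obtain i' where i': "i' \<in> \<rat>" "a < i'" "i' < a + r" using Rats_dense_in_real[of a "a + r"] r by auto
  obtain j where j: "j \<in> \<rat>" "b - r < j" "j < b" using Rats_dense_in_real[of "b - r" b] r by auto
  obtain j' where j': "j' \<in> \<rat>" "b < j'" "j' < b + r" using Rats_dense_in_real[of b "b + r"] r by auto
  have "2 * r \<le> b - a" "2 * r \<le> a + 1 - b" using r by (simp_all add: field_simps)
  then have "i' < j" "j' < i + 1" using i i' j j' by linarith+
  then have "(i, i', j, j') \<in> cell_index" using i i' j j' by (simp add: cell_index_def)
  then show thesis using that i i' j j' r by (meson less_le_trans le_less_trans add_left_mono diff_left_mono)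
qed

lemma cutpoints_eq_cells:
  "cutpoints (julia R) = (\<Union>(i, i', j, j') \<in> cell_index. cell i i' j j')"
proof (intro equalityI subsetI)
  fix g assume g: "g \<in> cutpoints (julia R)"
  then obtain a where a: "g = cls a" using cls_cases by (auto simp: cutpoints_def)
  then obtain b where b: "a < b" "b < a + 1" "E a b" using g cutpoint_iff by blast
  obtain i i' j j' where "(i, i', j, j') \<in> cell_index" "i < a" "a < i'" "j < b" "b < j'"
    using cell_around[OF b(1,2), of 1] by (metis zero_less_one)
  moreover from this have "g \<in> cell i i' j j'"
    unfolding a cls_in_cell_iff using b E_refl by (intro exI[of _ a] exI[of _ b]) auto
  ultimately show "g \<in> (\<Union>(i, i', j, j') \<in> cell_index. cell i i' j j')" by blast
next
  fix g assume "g \<in> (\<Union>(i, i', j, j') \<in> cell_index. cell i i' j j')"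
  then obtain i i' j j' where ix: "i' < j" "j' < i + 1" and g: "g \<in> cell i i' j j'"
    by (auto simp: cell_index_def)
  then obtain x where x: "g = cls x" using cls_cases by (auto simp: cell_def)
  then obtain s t where st: "i \<le> s" "s \<le> i'" "j \<le> t" "t \<le> j'" "E x s" "E x t"
    using g cls_in_cell_iff by auto
  have "E s t" using E_trans[OF E_sym[OF st(5)] st(6)] .
  moreover have "s < t" "t < s + 1" using st ix by linarith+
  ultimately have "cls s \<in> cutpoints (julia R)" unfolding cutpoint_iff by blast
  then show "g \<in> cutpoints (julia R)" using st(5) x cls_eq_iff[of x s] by simp
qed

lemma recurrent_cutpoint_in_closure:
  assumes "g \<in> cutpoints (julia R)"
    and rec: "\<And>i i' j j'. (i, i', j, j') \<in> cell_index \<Longrightarrow> g \<in> cell i i' j j' \<Longrightarrow>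
      \<exists>n\<ge>1. (top_poly d R ^^ n) g \<in> cell i i' j j'"
  shows "g \<in> julia R closure_of periodic_cutpoints (julia R) (top_poly d R)"
proof -
  obtain a where a: "g = cls a" using assms(1) cls_cases by (auto simp: cutpoints_def)
  then obtain b where b: "a < b" "b < a + 1" "E a b" using assms(1) cutpoint_iff by blast
  have "\<exists>n p t. 1 \<le> n \<and> \<bar>p - a\<bar> < \<delta> \<and> \<bar>t - b\<bar> < \<delta> \<and> E p t \<and> E p (real d ^ n * a)"
    if \<delta>: "\<delta> > 0" for \<delta>
  proof -
    obtain i i' j j' where ix: "(i, i', j, j') \<in> cell_index" "a - \<delta> < i" "i < a" "a < i'"
      "i' < a + \<delta>" "b - \<delta> < j" "j < b" "b < j'" "j' < b + \<delta>"
      using cell_around[OF b(1,2) \<delta>] by metis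
    have "g \<in> cell i i' j j'"
      unfolding a cls_in_cell_iff using ix b E_refl by (intro exI[of _ a] exI[of _ b]) auto
    then obtain n where n: "1 \<le> n" "cls (real d ^ n * a) \<in> cell i i' j j'"
      using rec[OF ix(1)] by (auto simp: a top_poly_funpow_cls)
    then obtain s t where st: "i \<le> s" "s \<le> i'" "j \<le> t" "t \<le> j'"
      "E (real d ^ n * a) s" "E (real d ^ n * a) t"
      unfolding cls_in_cell_iff by blast
    have "E s t" using E_trans[OF E_sym[OF st(5)] st(6)] .
    moreover have "\<bar>s - a\<bar> < \<delta>" "\<bar>t - b\<bar> < \<delta>" using st ix by (auto simp: abs_less_iff)
    ultimately show ?thesis using n(1) E_sym[OF st(5)] by blast
  qed
  then have "limit_of_periodic_cuts d a" using recurrent_cut_limit[OF compatible_d b] by blast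
  then show ?thesis unfolding a by (rule limit_in_closure)
qed

section \<open>Splitting an invariant measure\<close>


lemma cutpoints_measurable: "cutpoints (julia R) \<in> sets (borel_of (julia R))"
  unfolding cutpoints_eq_cells
  by (intro sets.countable_UN' countable_cell_index) (auto intro: closedin_in_borel_of closedin_cell)

lemma endpoints_measurable: "endpoints (julia R) \<in> sets (borel_of (julia R))"
proof -
  have "endpoints (julia R) = space (borel_of (julia R)) - cutpoints (julia R)"
    using topspace_split endpoints_cutpoints_disjoint by (auto simp: space_borel_of)
  then show ?thesis using sets.compl_sets[OF cutpoints_measurable] by simp
qed

lemma AE_cutpoint_in_closure:
  assumes "invariant_prob (julia R) (top_poly d R) M"
  shows "AE g in M. g \<in> cutpoints (julia R) \<longrightarrow>
    g \<in> julia R closure_of periodic_cutpoints (julia R) (top_poly d R)"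
proof -
  interpret prob_space M using assms by (simp add: invariant_prob_def)
  have M: "sets M = sets (borel_of (julia R))" "top_poly d R \<in> measurable M M"
    "\<forall>A\<in>sets M. measure M (top_poly d R -` A \<inter> space M) = measure M A"
    using assms by (auto simp: invariant_prob_def)
  define N where "N A = {g \<in> A. \<forall>n\<ge>1. (top_poly d R ^^ n) g \<notin> A}" for A
  have "N (cell i i' j j') \<in> null_sets M" for i i' j j'
    unfolding N_def
    by (rule poincare_recurrence[OF finite_measure_axioms M(2,3)])
      (simp add: M(1) closedin_in_borel_of closedin_cell)
  then have "(\<Union>(i, i', j, j')\<in>cell_index. N (cell i i' j j')) \<in> null_sets M"
    by (intro null_sets_UN' countable_cell_index) auto
  then show ?thesis
  proof (rule AE_I')
    show "{g \<in> space M. \<not> (g \<in> cutpoints (julia R) \<longrightarrow>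
        g \<in> julia R closure_of periodic_cutpoints (julia R) (top_poly d R))}
      \<subseteq> (\<Union>(i, i', j, j')\<in>cell_index. N (cell i i' j j'))"
    proof
      fix g assume "g \<in> {g \<in> space M. \<not> (g \<in> cutpoints (julia R) \<longrightarrow>
        g \<in> julia R closure_of periodic_cutpoints (julia R) (top_poly d R))}"
      then obtain i i' j j' where ix: "(i, i', j, j') \<in> cell_index" "g \<in> cell i i' j j'"
        "\<not> (\<exists>n\<ge>1. (top_poly d R ^^ n) g \<in> cell i i' j j')"
        using recurrent_cutpoint_in_closure[of g] by blast
      then have "g \<in> N (cell i i' j j')" by (auto simp: N_def)
      then show "g \<in> (\<Union>(i, i', j, j')\<in>cell_index. N (cell i i' j j'))" using ix(1) by blast
    qed
  qed
qed

text \<open>The set of endpoints is contained in its preimage, which has the same finite measure.\<close>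

lemma AE_endpoint_iff:
  assumes "invariant_prob (julia R) (top_poly d R) M"
  shows "AE g in M. top_poly d R g \<in> endpoints (julia R) \<longleftrightarrow> g \<in> endpoints (julia R)"
proof -
  interpret prob_space M using assms by (simp add: invariant_prob_def)
  let ?f = "top_poly d R" and ?E = "endpoints (julia R)"
  have M: "sets M = sets (borel_of (julia R))" "?f \<in> measurable M M"
    "\<forall>A\<in>sets M. measure M (?f -` A \<inter> space M) = measure M A"
    using assms by (auto simp: invariant_prob_def)
  have E: "?E \<in> sets M" using endpoints_measurable M(1) by simp
  have fE: "?f -` ?E \<inter> space M \<in> sets M" using M(2) E by (rule measurable_sets)
  have sub: "?E \<subseteq> ?f -` ?E \<inter> space M"
    using top_poly_endpoint sets.sets_into_space[OF E] by auto
  have "measure M ((?f -` ?E \<inter> space M) - ?E) = 0"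
    using finite_measure_Diff[OF fE E sub] M(3) E by simp
  then have "(?f -` ?E \<inter> space M) - ?E \<in> null_sets M"
    using fE E by (simp add: null_sets_def emeasure_eq_measure)
  then show ?thesis by (rule AE_I') (use top_poly_endpoint in auto)
qed

lemma funpow_endpoint: "g \<in> endpoints (julia R) \<Longrightarrow> (top_poly d R ^^ k) g \<in> endpoints (julia R)"
  by (induction k) (auto intro: top_poly_endpoint)

text \<open>An orbit that reaches an endpoint consists of endpoints from then on, and a periodic orbit comes
  back to its starting point.\<close>

lemma funpow_periodic_cutpoint:
  assumes "g \<in> periodic_cutpoints (julia R) (top_poly d R)"
  shows "(top_poly d R ^^ k) g \<in> periodic_cutpoints (julia R) (top_poly d R)"
proof -
  let ?f = "top_poly d R"
  obtain n where n: "1 \<le> n" "(?f ^^ n) g = g" using assms by (auto simp: periodic_cutpoints_def)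
  have per: "(?f ^^ n) ((?f ^^ k) g) = (?f ^^ k) g"
    using n(2) by (metis add.commute comp_apply funpow_add)
  have mult: "(?f ^^ (n * m)) g = g" for m
    by (induction m) (simp_all add: funpow_add n(2))
  obtain a where a: "g = cls a" using assms cls_cases by (auto simp: periodic_cutpoints_def cutpoints_def)
  have "(?f ^^ k) g \<in> cutpoints (julia R)"
  proof (rule ccontr)
    assume "(?f ^^ k) g \<notin> cutpoints (julia R)"
    then have "(?f ^^ k) g \<in> endpoints (julia R)" by (simp add: a top_poly_funpow_cls endpoint_iff)
    then have "(?f ^^ (n * k - k)) ((?f ^^ k) g) \<in> endpoints (julia R)" by (rule funpow_endpoint)
    moreover have "(n * k - k) + k = n * k" using n(1) by (cases n) simp_all
    then have "(?f ^^ (n * k - k)) ((?f ^^ k) g) = g" using mult[of k] by (metis comp_apply funpow_add)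
    ultimately show False using assms endpoints_cutpoints_disjoint by (auto simp: periodic_cutpoints_def)
  qed
  then show ?thesis using per n(1) by (auto simp: periodic_cutpoints_def)
qed

end

theorem corollary1p12:
  fixes d :: nat and R :: "(complex \<times> complex) set" and \<mu> :: "complex set measure"
  assumes "d \<ge> 2"
    and "invariant_lamination d R"
    and "dendrite (julia R)"
    and "invariant_prob (julia R) (top_poly d R) \<mu>"
  shows "\<exists>\<mu>\<^sub>e \<mu>\<^sub>c (t::real).
      invariant_prob (julia R) (top_poly d R) \<mu>\<^sub>e \<and>
      invariant_prob (julia R) (top_poly d R) \<mu>\<^sub>c \<and>
      supported_on \<mu>\<^sub>e (endpoints (julia R)) \<and>
      supported_on \<mu>\<^sub>c (cutpoints (julia R) \<inter>
        (julia R closure_of periodic_cutpoints (julia R) (top_poly d R))) \<and>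
      0 \<le> t \<and> t \<le> 1 \<and>
      (\<forall>A \<in> sets \<mu>. measure \<mu> A = t * measure \<mu>\<^sub>e A + (1 - t) * measure \<mu>\<^sub>c A)"
proof -
  interpret dendritic_lamination d R by standard (fact assms)+
  interpret prob_space \<mu> using assms(4) by (simp add: invariant_prob_def)
  let ?X = "julia R" and ?f = "top_poly d R"
  let ?P = "periodic_cutpoints ?X ?f"
  define En C L where "En = endpoints ?X" and "C = cutpoints ?X" and "L = C \<inter> ?X closure_of ?P"
  have \<mu>: "sets \<mu> = sets (borel_of ?X)" "?f \<in> measurable \<mu> \<mu>"
    using assms(4) by (auto simp: invariant_prob_def)
  have space: "space \<mu> = unit_circle // R"
    using sets_eq_imp_space_eq[OF \<mu>(1)] by (simp add: space_borel_of)
  have En: "En \<in> sets \<mu>" and C: "C \<in> sets \<mu>"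
    using endpoints_measurable cutpoints_measurable \<mu>(1) by (simp_all add: En_def C_def)
  have L: "L \<in> sets \<mu>"
    unfolding L_def using C \<mu>(1) closedin_in_borel_of[OF closedin_closure_of] by auto
  have split: "measure \<mu> A = measure \<mu> (En \<inter> A) + measure \<mu> (C \<inter> A)" if A: "A \<in> sets \<mu>" for A
  proof -
    have "A = (En \<inter> A) \<union> (C \<inter> A)"
      using sets.sets_into_space[OF A] space topspace_split by (auto simp: En_def C_def)
    moreover have "(En \<inter> A) \<inter> (C \<inter> A) = {}"
      using endpoints_cutpoints_disjoint by (auto simp: En_def C_def)
    ultimately show ?thesis using finite_measure_Union[of "En \<inter> A" "C \<inter> A"] En C A by simp
  qed
  have AE_E: "AE g in \<mu>. ?f g \<in> En \<longleftrightarrow> g \<in> En"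
    using AE_endpoint_iff[OF assms(4)] by (simp add: En_def)
  then have AE_C: "AE g in \<mu>. ?f g \<in> C \<longleftrightarrow> g \<in> C"
  proof (rule AE_mp)
    have "h \<in> C \<longleftrightarrow> h \<notin> En" if "h \<in> space \<mu>" for h
      using that space topspace_split endpoints_cutpoints_disjoint by (auto simp: En_def C_def)
    then show "AE g in \<mu>. (?f g \<in> En \<longleftrightarrow> g \<in> En) \<longrightarrow> (?f g \<in> C \<longleftrightarrow> g \<in> C)"
      using measurable_space[OF \<mu>(2)] by (intro AE_I2) simp
  qed
  have CL: "measure \<mu> (C \<inter> L) = measure \<mu> C"
    using AE_cutpoint_in_closure[OF assms(4)] C L
    by (intro finite_measure_eq_AE) (auto simp: L_def C_def)
  obtain g n where g: "g \<in> En" "1 \<le> n" "(?f ^^ n) g = g"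
    using exists_periodic_endpoint unfolding En_def by blast
  have "g \<in> space \<mu>" using g(1) sets.sets_into_space[OF En] by blast
  then obtain \<nu>\<^sub>e where \<nu>\<^sub>e: "invariant_prob ?X ?f \<nu>\<^sub>e" "supported_on \<nu>\<^sub>e En"
    using periodic_orbit_measure[OF \<mu> _ g(2,3) En] g(1) funpow_endpoint unfolding En_def by metis
  obtain h where h: "h \<in> ?P" using exists_periodic_cutpoint by blast
  then obtain m where m: "1 \<le> m" "(?f ^^ m) h = h" by (auto simp: periodic_cutpoints_def)
  have PL: "?P \<subseteq> L"
    unfolding L_def C_def using closure_of_subset[of ?P ?X] by (auto simp: periodic_cutpoints_def cutpoints_def)
  have "h \<in> space \<mu>" using h PL sets.sets_into_space[OF L] by blast
  then obtain \<nu>\<^sub>c where \<nu>\<^sub>c: "invariant_prob ?X ?f \<nu>\<^sub>c" "supported_on \<nu>\<^sub>c L"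
    using periodic_orbit_measure[OF \<mu> _ m L] funpow_periodic_cutpoint[OF h] PL by blast
  define t where "t = measure \<mu> En"
  have t: "0 \<le> t" "t \<le> 1" "measure \<mu> C = 1 - t"
    using split[of "space \<mu>"] sets.sets_into_space[OF En] sets.sets_into_space[OF C] prob_space
    by (simp_all add: t_def Int_absorb2)
  have em: "emeasure \<mu> En \<noteq> 0 \<longleftrightarrow> t \<noteq> 0" "emeasure \<mu> C \<noteq> 0 \<longleftrightarrow> t \<noteq> 1"
    "emeasure \<mu> B \<noteq> \<infinity>" for B
    using t by (simp_all add: emeasure_eq_measure t_def)
  \<comment> \<open>If the endpoints or the cutpoints are a null set, the measure on them has weight zero, and an orbit measure takes its place.\<close>
  define \<mu>\<^sub>e where "\<mu>\<^sub>e = (if t = 0 then \<nu>\<^sub>e else uniform_measure \<mu> En)"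
  define \<mu>\<^sub>c where "\<mu>\<^sub>c = (if t = 1 then \<nu>\<^sub>c else uniform_measure \<mu> C)"
  have "invariant_prob ?X ?f \<mu>\<^sub>e" "invariant_prob ?X ?f \<mu>\<^sub>c"
    using \<nu>\<^sub>e \<nu>\<^sub>c invariant_prob_restrict[OF assms(4) En _ AE_E] invariant_prob_restrict[OF assms(4) C _ AE_C] t
    by (simp_all add: \<mu>\<^sub>e_def \<mu>\<^sub>c_def t_def)
  moreover have "supported_on \<mu>\<^sub>e En"
    using \<nu>\<^sub>e(2) em En by (simp add: \<mu>\<^sub>e_def supported_on_def t_def)
  moreover have "supported_on \<mu>\<^sub>c L"
    using \<nu>\<^sub>c(2) em L CL t by (simp add: \<mu>\<^sub>c_def supported_on_def)
  moreover have "measure \<mu> A = t * measure \<mu>\<^sub>e A + (1 - t) * measure \<mu>\<^sub>c A" if A: "A \<in> sets \<mu>" for A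
  proof -
    have "measure \<mu> (En \<inter> A) \<le> t" "measure \<mu> (C \<inter> A) \<le> 1 - t"
      unfolding t(3)[symmetric] unfolding t_def using En C by (auto intro: finite_measure_mono)
    then have "t * measure \<mu>\<^sub>e A = measure \<mu> (En \<inter> A)" "(1 - t) * measure \<mu>\<^sub>c A = measure \<mu> (C \<inter> A)"
      using em A t
      by (auto simp: \<mu>\<^sub>e_def \<mu>\<^sub>c_def t_def[symmetric] measure_le_0_iff)
    then show ?thesis using split[OF A] by simp
  qed
  ultimately show ?thesis using t(1,2) unfolding En_def L_def C_def by blast
qed

end
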